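(* Let $n,k,t$ be positive integers with $k<n$ and $k\ge (n+3)/2$, and let $q$ be a prime power. If $\bar{B}$ is a minimal blocking set in $\mathrm{PG}(2,q)$ such that every point of $\bar{B}$ lies on at least $2$ tangent lines to $\bar{B}$, then there exists a minimal blocking set with respect to $(k-1)$-dimensional subspaces in $\mathrm{PG}(n-1,q^t)$ of size $|\bar{B}|q^{nt-kt-1}+\frac{q^{nt-kt-1}-1}{q-1}$.
   Context: A blocking set with respect to $j$-spaces in a projective space is a point set meeting every $j$-dimensional subspace; a blocking set in $\mathrm{PG}(2,q)$ is one with respect to lines. It is minimal if no proper subset has this property. A tangent line to $\bar B$ is a line meeting $\bar B$ in exactly one point. *)

theory Defs
  imports "HOL-Computational_Algebra.Primes" "HOL-Library.Cardinality"
begin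

text \<open>Vectors of the n-dimensional space F^n over a field F are modelled as
functions nat => F vanishing outside {0..<n}. PG(n-1,F) has as points the
1-dimensional linear subspaces of F^n; a projective j-space is a linear
subspace of dimension j+1; a point lies in a projective subspace iff it is
contained in it.\<close>

definition vecs :: "nat \<Rightarrow> (nat \<Rightarrow> 'a::field) set" where
  "vecs n = {v. \<forall>i\<ge>n. v i = 0}"

definition lcomb :: "(nat \<Rightarrow> 'a::field) list \<Rightarrow> (nat \<Rightarrow> 'a) \<Rightarrow> (nat \<Rightarrow> 'a)" where
  "lcomb vs c = (\<lambda>i. \<Sum>j<length vs. c j * (vs ! j) i)"

definition lspan :: "(nat \<Rightarrow> 'a::field) list \<Rightarrow> (nat \<Rightarrow> 'a) set" where
  "lspan vs = {lcomb vs c | c. True}"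

definition lin_indep :: "(nat \<Rightarrow> 'a::field) list \<Rightarrow> bool" where
  "lin_indep vs \<longleftrightarrow> (\<forall>c. lcomb vs c = (\<lambda>_. 0) \<longrightarrow> (\<forall>j<length vs. c j = 0))"

definition is_subsp :: "nat \<Rightarrow> nat \<Rightarrow> (nat \<Rightarrow> 'a::field) set \<Rightarrow> bool" where
  "is_subsp n d W \<longleftrightarrow>
     (\<exists>vs. length vs = d \<and> set vs \<subseteq> vecs n \<and> lin_indep vs \<and> W = lspan vs)"

definition proj_points :: "nat \<Rightarrow> (nat \<Rightarrow> 'a::field) set set" where
  "proj_points n = {P. is_subsp n 1 P}"

definition blocking_set :: "nat \<Rightarrow> nat \<Rightarrow> (nat \<Rightarrow> 'a::field) set set \<Rightarrow> bool" where
  "blocking_set n j B \<longleftrightarrow> B \<subseteq> proj_points n \<and>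
     (\<forall>W. is_subsp n (j+1) W \<longrightarrow> (\<exists>P\<in>B. P \<subseteq> W))"

definition minimal_blocking_set :: "nat \<Rightarrow> nat \<Rightarrow> (nat \<Rightarrow> 'a::field) set set \<Rightarrow> bool" where
  "minimal_blocking_set n j B \<longleftrightarrow> blocking_set n j B \<and>
     (\<forall>B'. B' \<subset> B \<longrightarrow> \<not> blocking_set n j B')"

definition tangent_lines :: "(nat \<Rightarrow> 'a::field) set set \<Rightarrow> (nat \<Rightarrow> 'a) set \<Rightarrow> (nat \<Rightarrow> 'a) set set" where
  "tangent_lines B P = {L. is_subsp 3 2 L \<and> {Q\<in>B. Q \<subseteq> L} = {P}}"

definition prime_power :: "nat \<Rightarrow> bool" where
  "prime_power q \<longleftrightarrow> (\<exists>p m. prime p \<and> m \<ge> 1 \<and> q = p ^ m)"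

end

theory Submission
  imports Defs "HOL-Number_Theory.Residues" "HOL-Computational_Algebra.Polynomial"
    "HOL-Library.Function_Algebras"
begin

text \<open>Put \<open>m = n - k\<close>, \<open>Q = q ^ t\<close>, and regard the \<open>n\<close>-space over \<open>GF(Q)\<close> as a space over \<open>GF(q)\<close>.
  A cone with base \<open>Bbar\<close> and a vertex of rank \<open>t * m - 1\<close>, spanning a scattered \<open>GF(q)\<close>-subspace \<open>U\<close>
  of rank \<open>t * m + 2\<close>, is projected to \<open>PG(n-1,Q)\<close>; scatteredness makes this injective on points,
  which gives the size. A \<open>k\<close>-dimensional \<open>W\<close> meets \<open>U\<close> in rank at least 2, so it meets the vertex
  or projects from it onto a set containing a line of the plane; either way it meets the cone.
  For minimality, the two tangents through the projection of a cone point \<open>x\<close> show that fewer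
  than \<open>Q ^ m\<close> \<open>GF(q)\<close>-lines join \<open>x\<close> to the rest of the cone, and so few obstructions can be
  avoided when a subspace through \<open>x\<close> is extended greedily to dimension \<open>k\<close>.\<close>

section \<open>Counting a set through the fibres of a map\<close>

lemma card_mult_le_of_fibers_ge:
  assumes "finite T" and "\<And>v. v \<in> T \<Longrightarrow> N \<le> card {w \<in> T. f w = f v}"
  shows "card (f ` T) * N \<le> card T"
proof -
  have "card (f ` T) * N = (\<Sum>y\<in>f ` T. N)" by simp
  also have "\<dots> \<le> (\<Sum>y\<in>f ` T. card {w \<in> T. f w = y})"
    by (intro sum_mono) (use assms(2) in auto)
  also have "\<dots> = card T"
    using sum.group[OF assms(1) finite_imageI[OF assms(1)] subset_refl, where g=f and h="\<lambda>_. 1::nat"] by simp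
  finally show ?thesis .
qed

lemma card_le_mult_of_fibers_le:
  assumes "finite T" and "\<And>v. v \<in> T \<Longrightarrow> card {w \<in> T. f w = f v} \<le> N"
  shows "card T \<le> card (f ` T) * N"
proof -
  have "card T = (\<Sum>y\<in>f ` T. card {w \<in> T. f w = y})"
    using sum.group[OF assms(1) finite_imageI[OF assms(1)] subset_refl, where g=f and h="\<lambda>_. 1::nat"] by simp
  also have "\<dots> \<le> (\<Sum>y\<in>f ` T. N)"
    by (intro sum_mono) (use assms(2) in auto)
  finally show ?thesis by simp
qed

subsection \<open>Finite fields\<close>

text \<open>Multiplication by a nonzero \<open>x\<close> permutes the nonzero elements; comparing
  their products before and after shows that the power with exponent \<open>CARD('a) - 1\<close> is
  1.\<close>

lemma power_CARD_eq_self: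
  fixes x :: "'a::{finite,field}"
  shows "x ^ CARD('a) = x"
proof (cases "x = 0")
  case False
  have "(\<Prod>y\<in>UNIV-{0}. y) = (\<Prod>y\<in>UNIV-{0}. x * y)"
    by (rule prod.reindex_bij_witness[of _ "\<lambda>y. x * y" "\<lambda>y. y / x"]) (use False in auto)
  also have "\<dots> = x ^ (CARD('a) - 1) * (\<Prod>y\<in>UNIV-{0}. y)"
    by (simp add: prod.distrib)
  finally have "x ^ (CARD('a) - 1) = 1" by simp
  then show ?thesis
    by (metis One_nat_def Suc_pred mult.right_neutral power_Suc zero_less_card_finite)
qed simp

text \<open>The type is packaged as an algebraic record \<open>R\<close> so that the cyclicity of
  the multiplicative group of a finite field can be quoted.\<close>

lemma finite_field_generator:
  obtains g :: "'a::{finite,field}" where "\<And>x. x \<noteq> 0 \<Longrightarrow> \<exists>i::nat. x = g ^ i"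
proof -
  define R where "R = \<lparr>carrier = (UNIV :: 'a set), monoid.mult = (*), one = (1 :: 'a), zero = (0 :: 'a), add = (+)\<rparr>"
  have "field R"
  proof -
    interpret R: cring R
    proof (rule cringI)
      show "abelian_group R"
      proof (rule abelian_groupI)
        fix x assume "x \<in> carrier R"
        show "\<exists>y\<in>carrier R. y \<oplus>\<^bsub>R\<^esub> x = \<zero>\<^bsub>R\<^esub>"
          by (rule bexI[of _ "-x"]) (auto simp: R_def)
      qed (auto simp: R_def algebra_simps)
      show "comm_monoid R" by (rule comm_monoidI) (auto simp: R_def algebra_simps)
    qed (auto simp: R_def algebra_simps)
    show ?thesis
    proof (rule R.cring_fieldI2)
      fix x assume "x \<in> carrier R" "x \<noteq> \<zero>\<^bsub>R\<^esub>"
      then show "\<exists>y\<in>carrier R. x \<otimes>\<^bsub>R\<^esub> y = \<one>\<^bsub>R\<^esub>"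
        by (intro bexI[of _ "inverse x"]) (auto simp: R_def)
    qed (simp add: R_def)
  qed
  then interpret R: field R .
  obtain g where g: "carrier (mult_of R) = {g [^]\<^bsub>R\<^esub> i | i::nat. i \<in> UNIV}"
    using R.finite_field_mult_group_has_gen by (auto simp: R_def)
  have "g [^]\<^bsub>R\<^esub> i = g ^ i" for i :: nat
    by (induction i) (auto simp: R_def nat_pow_def)
  with g have "UNIV - {0} = {g ^ i | i::nat. i \<in> UNIV}"
    by (simp add: carrier_mult_of) (simp add: R_def)
  then show thesis by (intro that[of g]) blast
qed

text \<open>Integer polynomials can be evaluated in both fields, so they carry relations from one
  type to the other without a separate type for the common prime field.\<close>

definition int_eval :: "int poly \<Rightarrow> 'a::comm_ring_1 \<Rightarrow> 'a" where
  "int_eval f = poly (map_poly of_int f)"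

lemma of_int_poly_add: "map_poly of_int (f + g) = map_poly of_int f + (map_poly of_int g :: 'a::comm_ring_1 poly)"
  by (intro poly_eqI) (simp add: coeff_map_poly)

lemma of_int_poly_mult: "map_poly of_int (f * g) = map_poly of_int f * (map_poly of_int g :: 'a::comm_ring_1 poly)"
  by (intro poly_eqI) (simp add: coeff_map_poly coeff_mult)

lemma int_eval_add: "int_eval (f + g) x = int_eval f x + int_eval g x"
  by (simp add: int_eval_def of_int_poly_add)

lemma int_eval_mult: "int_eval (f * g) x = int_eval f x * int_eval g x"
  by (simp add: int_eval_def of_int_poly_mult)

lemma int_eval_monom: "int_eval (monom 1 i) x = x ^ i"
  by (simp add: int_eval_def map_poly_monom poly_monom)

lemma int_eval_1: "int_eval 1 x = 1"
  by (simp add: int_eval_def)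

lemma int_eval_0: "int_eval 0 x = 0"
  by (simp add: int_eval_def)

lemma int_eval_minus: "int_eval (f - g) x = int_eval f x - int_eval g x"
  using int_eval_add[of "f - g" g x] by simp

lemma of_int_mod_CHAR:
  assumes "p = int CHAR('a::comm_ring_1)"
  shows "of_int (c mod p) = (of_int c :: 'a)"
proof -
  have "of_int p = (0::'a)" using assms by simp
  then have "of_int (c div p * p + c mod p) = (of_int (c mod p) :: 'a)"
    by (simp only: of_int_add of_int_mult) simp
  then show ?thesis by simp
qed

lemma prime_CHAR_finite_field: "prime (CHAR('a::{finite,field}))"
  by (simp add: finite_imp_CHAR_pos prime_CHAR_semidom)

text \<open>Reduce the coefficients modulo the characteristic \<open>p\<close>, multiply by an
  inverse of the new leading coefficient, and reduce again. Since the characteristics agree,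
  nonvanishing over \<open>'b\<close> guarantees that \<open>r\<close> is nonzero modulo
  \<open>p\<close>.\<close>

lemma monic_int_multiple_exists:
  fixes r :: "int poly" and g :: "'a::{finite,field}"
  assumes "int_eval r g = 0" and "map_poly of_int r \<noteq> (0::'b::{finite,field} poly)"
    and ch: "CHAR('b) = CHAR('a)"
  obtains r' :: "int poly"
  where "int_eval r' g = 0" "lead_coeff r' = 1" "degree r' \<le> degree r"
proof -
  define p where "p = int CHAR('a)"
  have p: "prime p" unfolding p_def using prime_CHAR_finite_field[where 'a='a] by simp
  then have "p > 1" by (rule prime_gt_1_int)
  have ofp: "of_int (c mod p) = (of_int c :: 'a)" for c
    by (rule of_int_mod_CHAR) (simp add: p_def)
  have ofpb: "of_int (c mod p) = (of_int c :: 'b)" for c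
    by (rule of_int_mod_CHAR) (simp add: p_def ch)
  define r1 where "r1 = map_poly (\<lambda>c. c mod p) r"
  have "map_poly of_int r1 = (map_poly of_int r :: 'b poly)"
    unfolding r1_def by (intro poly_eqI) (simp add: coeff_map_poly ofpb)
  with assms(2) have "r1 \<noteq> 0" by auto
  have r1g: "int_eval r1 g = 0"
  proof -
    have "map_poly of_int r1 = (map_poly of_int r :: 'a poly)"
      unfolding r1_def by (intro poly_eqI) (simp add: coeff_map_poly ofp)
    with assms(1) show ?thesis by (simp add: int_eval_def)
  qed
  define c where "c = lead_coeff r1"
  have "c \<noteq> 0" using \<open>r1 \<noteq> 0\<close> by (simp add: c_def)
  have "c = coeff r (degree r1) mod p" by (simp add: c_def r1_def coeff_map_poly)
  then have "\<not> p dvd c" using \<open>c \<noteq> 0\<close> \<open>p > 1\<close> by (auto simp: dvd_eq_mod_eq_0)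
  then have "coprime c p" using p by (metis coprime_commute prime_imp_coprime)
  then obtain d where "[c * d = 1] (mod p)" using cong_solve_coprime_int by blast
  then have d: "(d * c) mod p = 1" using \<open>p > 1\<close> by (simp add: cong_def mult.commute)
  define r' where "r' = map_poly (\<lambda>c. c mod p) (smult d r1)"
  have co: "coeff r' i = (d * coeff r1 i) mod p" for i
    by (simp add: r'_def coeff_map_poly)
  have deg: "degree r' = degree r1"
  proof (rule antisym)
    show "degree r' \<le> degree r1" by (rule degree_le) (auto simp: co coeff_eq_0)
    show "degree r1 \<le> degree r'" by (rule le_degree) (use d in \<open>simp add: co c_def\<close>)
  qed
  show thesis
  proof
    show "lead_coeff r' = 1" using d by (simp add: deg co c_def)
    have "degree r1 \<le> degree r" unfolding r1_def by (rule degree_le) (auto simp: coeff_map_poly coeff_eq_0)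
    then show "degree r' \<le> degree r" by (simp add: deg)
    have "map_poly of_int r' = smult (of_int d) (map_poly of_int r1 :: 'a poly)"
      by (intro poly_eqI) (simp add: coeff_map_poly co ofp)
    with r1g show "int_eval r' g = 0" by (simp add: int_eval_def)
  qed
qed

section \<open>Root counts for power equations\<close>

lemma degree_pow_minus:
  fixes f :: "'a::idom poly"
  assumes "degree f < n"
  shows "degree (monom 1 n - f) = n" "monom 1 n - f \<noteq> 0"
proof -
  show d: "degree (monom 1 n - f) = n"
    using assms by (simp add: diff_conv_add_uminus degree_add_eq_left degree_monom_eq del: add_uminus_conv_diff)
  show "monom 1 n - f \<noteq> 0" using d assms by auto
qed

lemma card_pow_eq_le:
  assumes "n > 0"
  shows "card {x::'a::idom. x ^ n = c} \<le> n"
proof -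
  have "degree [:c:] < n" using assms by simp
  note * = degree_pow_minus[OF this]
  have "card {x. poly (monom 1 n - [:c:]) x = 0} \<le> n"
    using card_poly_roots_bound[OF *(2)] *(1) by simp
  then show ?thesis by (simp add: poly_monom)
qed

lemma card_pow_eq_self_le:
  assumes "n > 1"
  shows "card {x::'a::idom. x ^ n = x} \<le> n"
proof -
  have "degree [:0, 1::'a:] < n" using assms by simp
  note * = degree_pow_minus[OF this]
  have "card {x. poly (monom 1 n - [:0,1::'a:]) x = 0} \<le> n"
    using card_poly_roots_bound[OF *(2)] *(1) by simp
  then show ?thesis by (simp add: poly_monom)
qed

text \<open>The degree gives the upper bound. For the lower one, write
  \<open>q ^ t - 1 = (q - 1) * M\<close>: the \<open>M\<close>-th powers of nonzero elements are
  fixed by the \<open>q\<close>-th power map, and each value is taken at most \<open>M\<close>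
  times, so at least \<open>q - 1\<close> values occur.\<close>

lemma card_pow_eq_self:
  fixes q t :: nat
  assumes "CARD('b::{finite,field}) = q ^ t" "q > 1" "t > 0"
  shows "card {x::'b. x ^ q = x} = q"
proof (rule antisym)
  show "card {x::'b. x ^ q = x} \<le> q" using card_pow_eq_self_le[OF \<open>q > 1\<close>] .
  have "(q - 1) dvd (q ^ t - 1)"
  proof -
    have "[q ^ t = 1 ^ t] (mod (q - 1))"
      by (rule cong_pow) (use assms in \<open>simp add: cong_altdef_nat\<close>)
    then show ?thesis using assms by (simp add: cong_altdef_nat)
  qed
  then obtain M where M: "q ^ t - 1 = (q - 1) * M" by (auto elim: dvdE)
  have "q ^ t > 1" using assms by (metis one_less_power)
  then have "M > 0" using M by (cases M) auto
  define N where "N = UNIV - {0::'b}"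
  have cN: "card N = (q - 1) * M" unfolding N_def M[symmetric] by (simp add: card_Diff_singleton assms(1))
  have pw: "x ^ (q ^ t - 1) = 1" if "x \<noteq> 0" for x :: 'b
  proof -
    have "x * x ^ (q ^ t - 1) = x" using power_CARD_eq_self[of x] assms \<open>q ^ t > 1\<close>
      by (metis One_nat_def Suc_pred less_trans power_Suc zero_less_one)
    then show ?thesis using that by simp
  qed
  have "card N \<le> card ((\<lambda>x. x ^ M) ` N) * M"
  proof (rule card_le_mult_of_fibers_le)
    fix v assume "v \<in> N"
    have "card {w \<in> N. w ^ M = v ^ M} \<le> card {w. w ^ M = v ^ M}" by (rule card_mono) auto
    also have "\<dots> \<le> M" by (rule card_pow_eq_le) (use \<open>M > 0\<close> in auto)
    finally show "card {w \<in> N. w ^ M = v ^ M} \<le> M" .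
  qed simp
  then have "q - 1 \<le> card ((\<lambda>x. x ^ M) ` N)" using cN \<open>M > 0\<close> by simp
  also have "\<dots> \<le> card ({x::'b. x ^ q = x} - {0})"
  proof (rule card_mono)
    show "(\<lambda>x. x ^ M) ` N \<subseteq> {x::'b. x ^ q = x} - {0}"
    proof (rule image_subsetI)
      fix x :: 'b assume "x \<in> N"
      then have "x \<noteq> 0" by (simp add: N_def)
      have "(x ^ M) ^ (q - 1) = 1" using pw[OF \<open>x \<noteq> 0\<close>] unfolding M by (metis mult.commute power_mult)
      then have "(x ^ M) ^ q = x ^ M"
        by (metis One_nat_def Suc_pred assms(2) less_trans mult.right_neutral power_Suc zero_less_one)
      then show "x ^ M \<in> {x. x ^ q = x} - {0}" using \<open>x \<noteq> 0\<close> by simp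
    qed
  qed simp
  also have "\<dots> = card {x::'b. x ^ q = x} - 1"
    using assms by (subst card_Diff_singleton) auto
  finally show "q \<le> card {x::'b. x ^ q = x}" using assms(2) by linarith
qed

section \<open>Embedding the small field into the large one\<close>

lemma int_eval_generator_surj:
  assumes "\<And>x::'a::{finite,field}. x \<noteq> 0 \<Longrightarrow> \<exists>i::nat. x = g ^ i"
  shows "\<exists>f. int_eval f g = x"
proof (cases "x = 0")
  case True
  then show ?thesis by (auto intro!: exI[of _ 0] simp: int_eval_0)
next
  case False
  then obtain i where "x = g ^ i" using assms by blast
  then show ?thesis by (auto intro!: exI[of _ "monom 1 i"] simp: int_eval_monom)
qed

text \<open>A monic integer polynomial \<open>m\<close> of least degree vanishing at \<open>g\<close> divides
  \<open>X ^ q - X\<close> modulo the characteristic. In \<open>'b\<close> the latter has \<open>q\<close> distinct roots,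
  and the cofactor of \<open>m\<close> accounts for fewer than \<open>q\<close> of them.\<close>
lemma common_root_exists:
  fixes g :: "'a::{finite,field}"
  assumes card: "CARD('b::{finite,field}) = CARD('a) ^ t" "t > 0"
    and ch: "CHAR('b::{finite,field}) = CHAR('a)"
  obtains h :: "'b::{finite,field}" where "\<And>f. int_eval f g = 0 \<Longrightarrow> int_eval f h = 0"
proof -
  define q where "q = CARD('a)"
  have "card {0, 1 :: 'a} \<le> q" unfolding q_def by (rule card_mono) auto
  then have "q > 1" by simp
  define F where "F = (monom 1 q - monom 1 1 :: int poly)"
  have Fx: "int_eval F x = x ^ q - x" for x :: "'c::comm_ring_1"
    by (simp add: F_def int_eval_minus int_eval_monom)
  define P where "P f \<longleftrightarrow> lead_coeff f = 1 \<and> int_eval f g = 0" for f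
  have "P F"
  proof -
    have deg: "degree (monom 1 1 :: int poly) < q" using \<open>q > 1\<close> by (simp add: degree_monom_eq)
    have "int_eval F g = 0" by (simp add: Fx q_def power_CARD_eq_self)
    moreover have "lead_coeff F = 1"
      using degree_pow_minus[OF deg] \<open>q > 1\<close> by (simp add: F_def)
    ultimately show ?thesis by (simp add: P_def)
  qed
  then obtain m where m: "P m" and least: "\<And>f. P f \<Longrightarrow> degree m \<le> degree f"
    using ex_has_least_nat[of P F degree] by auto
  have "m \<noteq> 0" using m by (auto simp: P_def)
  have divides: "\<exists>s. map_poly of_int f = map_poly of_int m * (s :: 'b poly) \<and> degree s \<le> degree f - degree m"
    if "int_eval f g = 0" for f
  proof -
    \<comment> \<open>As \<open>m\<close> is monic, pseudo-division introduces no extra factor in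
      front of \<open>f\<close>.\<close>
    obtain s r where sr: "pseudo_divmod f m = (s, r)" by (cases "pseudo_divmod f m")
    from pseudo_divmod[OF \<open>m \<noteq> 0\<close> this] m
    have f: "f = m * s + r" and r: "r = 0 \<or> degree r < degree m" by (auto simp: P_def)
    have "int_eval r g = 0"
      using that m by (simp add: f int_eval_add int_eval_mult P_def)
    \<comment> \<open>A remainder that survives over \<open>'b\<close> would yield a monic
      polynomial of smaller degree than \<open>m\<close> vanishing at \<open>g\<close>.\<close>
    have r0: "map_poly of_int r = (0 :: 'b poly)"
    proof (rule ccontr)
      assume "\<not> ?thesis"
      then obtain r' where r': "int_eval r' g = 0" "lead_coeff r' = 1" "degree r' \<le> degree r"
        using monic_int_multiple_exists[OF \<open>int_eval r g = 0\<close> _ ch] by blast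
      then have "degree m \<le> degree r" using least[of r'] by (simp add: P_def)
      with r have "r = 0" by auto
      with \<open>\<not> ?thesis\<close> show False by simp
    qed
    have "degree s \<le> degree f - degree m"
    proof (cases "s = 0")
      case False
      have "degree (m * s) = degree m + degree s" using \<open>m \<noteq> 0\<close> False by (rule degree_mult_eq)
      moreover from this r have "degree f = degree (m * s)"
        unfolding f by (cases "r = 0") (simp_all add: degree_add_eq_left)
      ultimately show ?thesis by simp
    qed simp
    moreover have "degree (map_poly of_int s :: 'b poly) \<le> degree s"
      by (rule degree_le) (simp add: coeff_map_poly coeff_eq_0)
    ultimately show ?thesis
      by (intro exI[of _ "map_poly of_int s"]) (simp add: f of_int_poly_add of_int_poly_mult r0)
  qed
  have "degree m > 0"
  proof (rule ccontr)
    assume "\<not> ?thesis"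
    then obtain a where "m = [:a:]" by (auto elim: degree_eq_zeroE)
    then have "m = 1" using m by (simp add: P_def one_pCons)
    then show False using m by (simp add: P_def int_eval_1)
  qed
  have degF: "degree F = q"
    using degree_pow_minus(1)[of "monom 1 1 :: int poly" q] \<open>q > 1\<close> by (simp add: F_def degree_monom_eq)
  obtain s :: "'b poly" where s: "map_poly of_int F = map_poly of_int m * s" "degree s \<le> q - degree m"
    using divides[of F] \<open>P F\<close> degF by (auto simp: P_def)
  have split: "x ^ q - x = int_eval m x * poly s x" for x
    using arg_cong[OF s(1), of "\<lambda>f. poly f x"] Fx[of x] by (simp add: int_eval_def)
  have card_q: "card {x::'b. x ^ q = x} = q"
    by (rule card_pow_eq_self) (use card \<open>q > 1\<close> in \<open>auto simp: q_def\<close>)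
  have "\<exists>h::'b. int_eval m h = 0"
  proof (rule ccontr)
    assume no: "\<nexists>h::'b. int_eval m h = 0"
    have "s \<noteq> 0"
    proof
      assume "s = 0"
      then have "map_poly of_int F = (0 :: 'b poly)" using s by simp
      then have "coeff (map_poly of_int F) q = (0::'b)" by simp
      then show False using \<open>P F\<close> degF by (simp add: coeff_map_poly P_def)
    qed
    have "{x. x ^ q = x} \<subseteq> {x. poly s x = 0}"
      using split no by (metis (mono_tags, lifting) diff_self mem_Collect_eq mult_eq_0_iff subsetI)
    then have "q \<le> card {x. poly s x = 0}" using card_q by (metis card_mono finite)
    also have "\<dots> \<le> degree s" by (rule card_poly_roots_bound) fact
    finally show False using s(2) \<open>degree m > 0\<close> \<open>q > 1\<close> by simp
  qed
  then obtain h :: 'b where h: "int_eval m h = 0" ..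
  show thesis
  proof (rule that[of h])
    fix f assume "int_eval f g = 0"
    then obtain s :: "'b poly" where "map_poly of_int f = map_poly of_int m * s" using divides by blast
    then show "int_eval f h = 0" using h by (simp add: int_eval_def)
  qed
qed

text \<open>Every element is the value of an integer polynomial at a generator \<open>g\<close>.
  Evaluating the same polynomial at the root \<open>h\<close> instead respects sums and products
  because evaluation does.\<close>

lemma finite_field_embedding:
  assumes card: "CARD('b::{finite,field}) = CARD('a::{finite,field}) ^ t" "t > 0"
    and ch: "CHAR('b::{finite,field}) = CHAR('a::{finite,field})"
  obtains \<iota> :: "'a::{finite,field} \<Rightarrow> 'b::{finite,field}"
  where "\<And>x y. \<iota> (x + y) = \<iota> x + \<iota> y" "\<And>x y. \<iota> (x * y) = \<iota> x * \<iota> y" "\<iota> 1 = 1"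
proof -
  obtain g :: 'a where g: "\<And>x. x \<noteq> 0 \<Longrightarrow> \<exists>i::nat. x = g ^ i" using finite_field_generator by blast
  obtain h :: 'b where h: "\<And>f. int_eval f g = 0 \<Longrightarrow> int_eval f h = 0"
    using common_root_exists[OF card ch] by blast
  \<comment> \<open>The choice made by \<open>rep\<close> is immaterial: two polynomials that agree
    at \<open>g\<close> differ by one vanishing at \<open>g\<close>, hence at
    \<open>h\<close>.\<close>
  define rep where "rep x = (SOME f. int_eval f g = x)" for x
  define \<iota> where "\<iota> x = int_eval (rep x) h" for x
  have "int_eval (rep x) g = x" for x
    unfolding rep_def using int_eval_generator_surj[OF g] by (rule someI_ex)
  then have \<iota>: "\<iota> (int_eval f g) = int_eval f h" for f
    using h[of "rep (int_eval f g) - f"] by (simp add: int_eval_minus \<iota>_def)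
  show thesis
  proof
    fix x y
    obtain f f' where f: "x = int_eval f g" "y = int_eval f' g" using int_eval_generator_surj[OF g] by metis
    show "\<iota> (x + y) = \<iota> x + \<iota> y" by (simp add: f \<iota> flip: int_eval_add)
    show "\<iota> (x * y) = \<iota> x * \<iota> y" by (simp add: f \<iota> flip: int_eval_mult)
    show "\<iota> 1 = 1" using \<iota>[of 1] by (simp add: int_eval_1)
  qed
qed

lemma CHAR_CARD_prime_power:
  assumes "CARD('a::{finite,field}) = p ^ e" "prime p"
  shows "CHAR('a) = p"
  using CHAR_dvd_CARD[where 'a='a] assms prime_CHAR_finite_field[where 'a='a]
  by (metis prime_dvd_power primes_dvd_imp_eq)

subsection \<open>Vectors and spans\<close>

definition vscale :: "'a::field \<Rightarrow> (nat \<Rightarrow> 'a) \<Rightarrow> nat \<Rightarrow> 'a"  (infixr \<open>\<odot>\<close> 75) where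
  "c \<odot> v = (\<lambda>i. c * v i)"

lemma vscale_apply [simp]: "(c \<odot> v) i = c * v i"
  by (simp add: vscale_def)

lemma vscale_simps [simp]: "0 \<odot> v = 0" "1 \<odot> v = v" "c \<odot> 0 = 0" "a \<odot> b \<odot> v = (a * b) \<odot> v"
  by (simp_all add: fun_eq_iff)

lemma vscale_algebra: "c \<odot> (v + w) = c \<odot> v + c \<odot> w" "(a + b) \<odot> v = a \<odot> v + b \<odot> v"
  "c \<odot> (v - w) = c \<odot> v - c \<odot> w" "(a - b) \<odot> v = a \<odot> v - b \<odot> v" "(- a) \<odot> v = - (a \<odot> v)"
  by (simp_all add: fun_eq_iff algebra_simps)

lemma vscale_eq_0_iff [simp]: "c \<odot> v = 0 \<longleftrightarrow> c = 0 \<or> v = 0"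
  by (auto simp: fun_eq_iff)

lemma vscale_cancel: "a \<noteq> 0 \<Longrightarrow> a \<odot> v = w \<longleftrightarrow> v = inverse a \<odot> w"
  by (auto simp: fun_eq_iff field_simps)

lemma vscale_cancel_right: "v \<noteq> 0 \<Longrightarrow> a \<odot> v = b \<odot> v \<longleftrightarrow> a = b"
  by (auto simp: fun_eq_iff)

lemma vecs_closed [intro]:
  "0 \<in> vecs n" "v \<in> vecs n \<Longrightarrow> w \<in> vecs n \<Longrightarrow> v + w \<in> vecs n"
  "v \<in> vecs n \<Longrightarrow> w \<in> vecs n \<Longrightarrow> v - w \<in> vecs n"
  "v \<in> vecs n \<Longrightarrow> c \<odot> v \<in> vecs n"
  by (auto simp: vecs_def)

lemma card_vecs_constrained:
  "card {v \<in> vecs n. \<forall>i<n. v i \<in> S i} = (\<Prod>i<n. card (S i :: 'a::{finite,field} set))"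
proof -
  have "bij_betw (\<lambda>v. restrict v {..<n}) {v \<in> vecs n. \<forall>i<n. v i \<in> S i} (PiE {..<n} S)"
    by (rule bij_betwI[where g="\<lambda>v i. if i < n then v i else 0"])
      (auto simp: vecs_def fun_eq_iff PiE_def extensional_def)
  then show ?thesis by (simp add: bij_betw_same_card card_PiE)
qed

lemma card_vecs: "card (vecs n :: (nat \<Rightarrow> 'a::{finite,field}) set) = CARD('a) ^ n"
  using card_vecs_constrained[where S="\<lambda>_. UNIV :: 'a set"] by simp

lemma finite_vecs [simp]: "finite (vecs n :: (nat \<Rightarrow> 'a::{finite,field}) set)"
  by (rule card_ge_0_finite) (simp add: card_vecs)

section \<open>Linear combinations, spans and independence\<close>

lemma lcomb_snoc: "lcomb (vs @ [z]) c = lcomb vs c + c (length vs) \<odot> z"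
  by (auto simp: lcomb_def fun_eq_iff nth_append intro!: sum.cong)

lemma lcomb_cong: "(\<And>j. j < length vs \<Longrightarrow> c j = d j) \<Longrightarrow> lcomb vs c = lcomb vs d"
  by (simp add: lcomb_def)

lemma lspan_Nil: "lspan [] = {0}"
  by (auto simp: lspan_def lcomb_def zero_fun_def)

lemma lspan_snoc: "lspan (vs @ [z]) = (\<lambda>(w, c). w + c \<odot> z) ` (lspan vs \<times> UNIV)"
proof -
  have "lcomb vs c + b \<odot> z \<in> lspan (vs @ [z])" for c b
  proof -
    have "lcomb (vs @ [z]) (c(length vs := b)) = lcomb vs c + b \<odot> z"
      unfolding lcomb_snoc by (simp cong: lcomb_cong)
    then show ?thesis unfolding lspan_def by (metis (mono_tags, lifting) mem_Collect_eq)
  qed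
  moreover have "lspan (vs @ [z]) \<subseteq> (\<lambda>(w, c). w + c \<odot> z) ` (lspan vs \<times> UNIV)"
    by (auto simp: lspan_def lcomb_snoc)
  ultimately show ?thesis by (auto simp: lspan_def)
qed

lemma lspan_single: "lspan [x] = range (\<lambda>c. c \<odot> x)"
  using lspan_snoc[of "[]" x] by (auto simp: lspan_Nil image_iff)

lemma lspan_closed:
  "0 \<in> lspan vs"
  "v \<in> lspan vs \<Longrightarrow> w \<in> lspan vs \<Longrightarrow> v + w \<in> lspan vs"
  "v \<in> lspan vs \<Longrightarrow> c \<odot> v \<in> lspan vs"
proof -
  show "0 \<in> lspan vs"
    by (auto simp: lspan_def lcomb_def fun_eq_iff intro!: exI[of _ "\<lambda>_. 0"])
  show "v + w \<in> lspan vs" if vw: "v \<in> lspan vs" "w \<in> lspan vs"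
  proof -
    obtain c d where "v = lcomb vs c" "w = lcomb vs d" using vw by (auto simp: lspan_def)
    then have "v + w = lcomb vs (\<lambda>j. c j + d j)"
      by (simp add: lcomb_def fun_eq_iff sum.distrib algebra_simps)
    then show ?thesis by (auto simp: lspan_def)
  qed
  show "c \<odot> v \<in> lspan vs" if v: "v \<in> lspan vs"
  proof -
    obtain d where "v = lcomb vs d" using v by (auto simp: lspan_def)
    then have "c \<odot> v = lcomb vs (\<lambda>j. c * d j)"
      by (simp add: lcomb_def fun_eq_iff sum_distrib_left algebra_simps)
    then show ?thesis by (auto simp: lspan_def)
  qed
qed

lemma lspan_diff: "v \<in> lspan vs \<Longrightarrow> w \<in> lspan vs \<Longrightarrow> v - w \<in> lspan vs"
  using lspan_closed(2)[OF _ lspan_closed(3)[of w vs "-1"], of v]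
  by (simp add: vscale_algebra)

lemma lspan_subset_vecs: "set vs \<subseteq> vecs n \<Longrightarrow> lspan vs \<subseteq> vecs n"
  by (induction vs rule: rev_induct) (auto simp: lspan_Nil lspan_snoc)

lemma lin_indep_iff: "lin_indep vs \<longleftrightarrow> (\<forall>c. lcomb vs c = 0 \<longrightarrow> (\<forall>j<length vs. c j = 0))"
  by (simp add: lin_indep_def zero_fun_def)

lemma lin_indep_Nil: "lin_indep []"
  by (simp add: lin_indep_def)

text \<open>This recursive form of independence supports induction from the end of the list and the
  vector-by-vector construction of subspaces.\<close>

lemma lin_indep_snoc: "lin_indep (vs @ [z]) \<longleftrightarrow> lin_indep vs \<and> z \<notin> lspan vs"
proof
  assume L: "lin_indep (vs @ [z])"
  have "lin_indep vs"
    unfolding lin_indep_iff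
  proof (intro allI impI)
    fix c j assume c: "lcomb vs c = 0" and j: "j < length vs"
    have "lcomb (vs @ [z]) (c(length vs := 0)) = 0"
      using c unfolding lcomb_snoc by (simp cong: lcomb_cong)
    with L j have "(c(length vs := 0)) j = 0" unfolding lin_indep_iff by (metis length_append_singleton less_SucI)
    then show "c j = 0" using j by simp
  qed
  moreover have "z \<notin> lspan vs"
  proof
    assume "z \<in> lspan vs"
    then obtain c where "z = lcomb vs c" by (auto simp: lspan_def)
    \<comment> \<open>Coefficient -1 on \<open>z\<close> turns the representation of
      \<open>z\<close> into a nontrivial relation.\<close>
    then have "lcomb (vs @ [z]) (c(length vs := -1)) = 0"
      unfolding lcomb_snoc by (simp add: vscale_algebra cong: lcomb_cong)
    with L have "(c(length vs := -1)) (length vs) = 0" unfolding lin_indep_iff by (metis length_append_singleton lessI)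
    then show False by simp
  qed
  ultimately show "lin_indep vs \<and> z \<notin> lspan vs" ..
next
  assume R: "lin_indep vs \<and> z \<notin> lspan vs"
  show "lin_indep (vs @ [z])"
    unfolding lin_indep_iff
  proof (intro allI impI)
    fix c j assume c: "lcomb (vs @ [z]) c = 0" and j: "j < length (vs @ [z])"
    have "c (length vs) = 0"
    proof (rule ccontr)
      assume nz: "c (length vs) \<noteq> 0"
      have "c (length vs) \<odot> z = - 1 \<odot> lcomb vs c"
        using c by (simp add: lcomb_snoc vscale_algebra eq_neg_iff_add_eq_0 add.commute)
      then have "z = (inverse (c (length vs)) * - 1) \<odot> lcomb vs c" using nz by (simp add: vscale_cancel)
      moreover have "lcomb vs c \<in> lspan vs" by (auto simp: lspan_def)
      ultimately show False using R lspan_closed(3) by metis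
    qed
    moreover from this c R have "\<forall>j<length vs. c j = 0" by (simp add: lcomb_snoc lin_indep_iff)
    ultimately show "c j = 0" using j by (auto simp: less_Suc_eq)
  qed
qed

lemma card_lspan:
  "lin_indep (vs :: (nat \<Rightarrow> 'a::{finite,field}) list) \<Longrightarrow> card (lspan vs) = CARD('a) ^ length vs"
proof (induction vs rule: rev_induct)
  case (snoc z vs)
  then have ind: "lin_indep vs" "z \<notin> lspan vs" by (auto simp: lin_indep_snoc)
  have "inj_on (\<lambda>(w, c). w + c \<odot> z) (lspan vs \<times> UNIV)"
  proof (rule inj_onI, clarify)
    fix w c w' c' assume w: "w \<in> lspan vs" "w' \<in> lspan vs" and eq: "w + c \<odot> z = w' + c' \<odot> z"
    have e: "(c - c') \<odot> z = w' - w" using eq by (simp add: vscale_algebra algebra_simps)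
    have "c = c'"
    proof (rule ccontr)
      assume "c \<noteq> c'"
      then have "z = inverse (c - c') \<odot> (w' - w)" using e by (simp add: vscale_cancel)
      then show False using ind w lspan_diff lspan_closed(3) by metis
    qed
    then show "w = w' \<and> c = c'" using eq by simp
  qed
  then have "card (lspan (vs @ [z])) = card (lspan vs \<times> (UNIV :: 'a set))"
    unfolding lspan_snoc by (rule card_image)
  then show ?case using snoc ind by (simp add: card_cartesian_product)
qed (simp add: lspan_Nil)

section \<open>Subspaces and projective points\<close>

lemma is_subsp_closed:
  assumes "is_subsp n d W"
  shows "0 \<in> W" "v \<in> W \<Longrightarrow> w \<in> W \<Longrightarrow> v + w \<in> W" "v \<in> W \<Longrightarrow> w \<in> W \<Longrightarrow> v - w \<in> W"
    "v \<in> W \<Longrightarrow> c \<odot> v \<in> W" "W \<subseteq> vecs n"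
  using assms lspan_closed lspan_diff lspan_subset_vecs unfolding is_subsp_def by metis+

lemma card_is_subsp:
  assumes "is_subsp n d (W :: (nat \<Rightarrow> 'a::{finite,field}) set)"
  shows "card W = CARD('a) ^ d"
  using assms card_lspan unfolding is_subsp_def by metis

lemma lin_indep_single: "lin_indep [x] \<longleftrightarrow> x \<noteq> 0"
  using lin_indep_snoc[of "[]" x] by (simp add: lspan_Nil lin_indep_Nil)

lemma proj_points_iff: "P \<in> proj_points n \<longleftrightarrow> (\<exists>x\<in>vecs n. x \<noteq> 0 \<and> P = lspan [x])"
  by (auto simp: proj_points_def is_subsp_def lin_indep_single length_Suc_conv)

lemma lspan_single_eq:
  assumes "y \<in> lspan [x]" "y \<noteq> 0"
  shows "lspan [y] = lspan [x]"
proof -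
  obtain c where c: "y = c \<odot> x" using assms by (auto simp: lspan_single)
  with assms have "c \<noteq> 0" by auto
  then have "b \<odot> x = (b * inverse c) \<odot> y" for b by (simp add: c mult.assoc)
  then show ?thesis unfolding lspan_single c by auto
qed

text \<open>Incidence of a projective point with a subspace becomes membership of any representing
  vector.\<close>

lemma lspan_single_subset_iff:
  assumes "is_subsp n d W"
  shows "lspan [x] \<subseteq> W \<longleftrightarrow> x \<in> W"
proof
  show "x \<in> W" if "lspan [x] \<subseteq> W"
    using that unfolding lspan_single by (metis rangeI subsetD vscale_simps(2))
qed (use is_subsp_closed[OF assms] in \<open>auto simp: lspan_single\<close>)

lemma is_subsp_2_exists:
  assumes "x \<in> vecs n" "x \<noteq> 0" "y \<in> vecs n" "y \<notin> lspan [x]"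
  shows "is_subsp n 2 (lspan [x, y])"
  unfolding is_subsp_def
  using assms lin_indep_snoc[of "[x]" y]
  by (intro exI[of _ "[x, y]"]) (auto simp: lin_indep_single)

lemma lspan_pair: "lspan [x, y] = (\<lambda>(a, b). a \<odot> x + b \<odot> y) ` UNIV"
  using lspan_snoc[of "[x]" y] by (force simp: lspan_single image_iff)

text \<open>Greedy extension by vectors outside all the spaces \<open>lspan [vs, s]\<close>, \<open>s \<in> S\<close>,
  which are too few to cover \<open>vecs n\<close>.\<close>
lemma subspace_avoiding_exists:
  fixes x :: "nat \<Rightarrow> 'b::{finite,field}"
  assumes x: "x \<in> vecs n" "x \<noteq> 0" and S: "finite S" "S \<inter> lspan [x] = {}"
    and card: "card S < CARD('b) ^ (n - k)" and k: "1 \<le> k" "k \<le> n"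
  obtains W where "is_subsp n k W" "x \<in> W" "W \<inter> S = {}"
proof -
  define Q where "Q = CARD('b)"
  have "card {0, 1 :: 'b} \<le> Q" unfolding Q_def by (rule card_mono) auto
  then have "Q > 1" by simp
  \<comment> \<open>The construction starts from \<open>[x]\<close>, so stage \<open>i\<close> has
    \<open>Suc i\<close> vectors and dimension \<open>k\<close> is reached at stage
    \<open>k - 1\<close>.\<close>
  have "\<exists>vs. length vs = Suc i \<and> set vs \<subseteq> vecs n \<and> lin_indep vs \<and> x \<in> lspan vs \<and> lspan vs \<inter> S = {}"
    if "i < k" for i
    using that
  proof (induction i)
    case 0
    have "x \<in> lspan [x]" unfolding lspan_single by (metis rangeI vscale_simps(2))
    then show ?case using x S by (intro exI[of _ "[x]"]) (auto simp: lin_indep_single)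
  next
    case (Suc i)
    then obtain vs where vs: "length vs = Suc i" "set vs \<subseteq> vecs n" "lin_indep vs" "x \<in> lspan vs"
      "lspan vs \<inter> S = {}" by auto
    define V where "V = lspan vs"
    \<comment> \<open>If adjoining \<open>z\<close> to \<open>V\<close> captured some
      \<open>s\<close> in \<open>S\<close>, then \<open>s = w + c \<odot> z\<close> with
      \<open>c\<close> nonzero; solving for \<open>z\<close> puts it into
      \<open>bad\<close>.\<close>
    define bad where "bad = (\<lambda>((w, c), s). w + c \<odot> s) ` ((V \<times> (UNIV - {0})) \<times> S)"
    have finV: "finite V" and cV: "card V = Q ^ Suc i"
      using card_lspan[OF vs(3)] vs(1) \<open>Q > 1\<close> unfolding V_def Q_def
      by (auto intro: card_ge_0_finite)
    have "card bad \<le> card ((V \<times> (UNIV - {0::'b})) \<times> S)"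
      unfolding bad_def by (intro card_image_le finite_cartesian_product) (use finV S in auto)
    also have "\<dots> = Q ^ Suc i * (Q - 1) * card S"
      by (simp add: card_cartesian_product cV card_Diff_singleton Q_def)
    also have "\<dots> \<le> Q ^ Suc i * (Q - 1) * (Q ^ (n - k) - 1)"
      using card by (intro mult_left_mono) (auto simp: Q_def)
    finally have cb: "card bad \<le> Q ^ Suc i * (Q - 1) * (Q ^ (n - k) - 1)" .
    have "card (V \<union> bad) \<le> Q ^ Suc i + Q ^ Suc i * (Q - 1) * (Q ^ (n - k) - 1)"
      using card_Un_le[of V bad] cV cb by linarith
    also have "\<dots> = Q ^ Suc i * (1 + (Q - 1) * (Q ^ (n - k) - 1))"
      by (simp add: algebra_simps)
    also have "\<dots> < Q ^ Suc i * (Q * Q ^ (n - k))"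
    proof (rule mult_strict_left_mono)
      obtain a b where "Q = Suc (Suc a)" "Q ^ (n - k) = Suc b"
        using \<open>Q > 1\<close> by (metis Suc_lessE gr0_conv_Suc zero_less_power less_trans zero_less_one One_nat_def)
      then show "1 + (Q - 1) * (Q ^ (n - k) - 1) < Q * Q ^ (n - k)" by simp
    qed (use \<open>Q > 1\<close> in simp)
    also have "\<dots> = Q ^ (Suc i + Suc (n - k))" by (simp only: power_add power_Suc)
    \<comment> \<open>The premise \<open>Suc i < k\<close> leaves exactly enough room for this
      exponent.\<close>
    also have "\<dots> \<le> Q ^ n" using Suc.prems k \<open>Q > 1\<close> by (intro power_increasing) auto
    also have "\<dots> = card (vecs n :: (nat \<Rightarrow> 'b) set)" by (simp add: card_vecs Q_def)
    finally have "\<not> vecs n \<subseteq> V \<union> bad"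
      using card_mono[of "V \<union> bad" "vecs n"] finV S by (auto simp: bad_def)
    then obtain z where z: "z \<in> vecs n" "z \<notin> V" "z \<notin> bad" by auto
    have "s \<notin> lspan (vs @ [z])" if "s \<in> S" for s
    proof
      assume "s \<in> lspan (vs @ [z])"
      then obtain w c where w: "w \<in> V" "s = w + c \<odot> z" by (auto simp: lspan_snoc V_def)
      have "c \<noteq> 0" using w vs(5) that unfolding V_def by auto
      have "z = inverse c \<odot> (s - w)" using w \<open>c \<noteq> 0\<close> by simp
      then have "z = (- inverse c) \<odot> w + inverse c \<odot> s" by (simp add: vscale_algebra)
      then have "z \<in> bad" unfolding bad_def
        using \<open>c \<noteq> 0\<close> that w lspan_closed(3)[of w vs "- inverse c"]
        by (intro image_eqI[of _ _ "((- inverse c \<odot> w, inverse c), s)"]) (auto simp: V_def)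
      then show False using z by simp
    qed
    moreover have "x \<in> lspan (vs @ [z])"
      using vs(4) unfolding lspan_snoc by (intro image_eqI[of _ _ "(x, 0)"]) auto
    ultimately show ?case using vs z
      by (intro exI[of _ "vs @ [z]"]) (auto simp: lin_indep_snoc V_def)
  qed
  from this[of "k - 1"] k obtain vs where "length vs = k" "set vs \<subseteq> vecs n" "lin_indep vs"
    "x \<in> lspan vs" "lspan vs \<inter> S = {}" by auto
  then show thesis by (intro that[of "lspan vs"]) (auto simp: is_subsp_def)
qed

subsection \<open>A scattered subspace\<close>

text \<open>Additivity of the \<open>q\<close>-th power map enters as an assumption; it is supplied
  later from the characteristic. It makes that map linear over the image of
  \<open>\<iota>\<close>.\<close>

locale scattered_embedding =
  fixes \<iota> :: "'a::{finite,field} \<Rightarrow> 'b::{finite,field}" and q t m :: nat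
  assumes card_a: "CARD('a) = q" and card_b: "CARD('b) = q ^ t"
    and pos: "t > 0" "m > 0"
    and hom_add: "\<iota> (x + y) = \<iota> x + \<iota> y"
    and hom_mult: "\<iota> (x * y) = \<iota> x * \<iota> y"
    and hom_1: "\<iota> 1 = 1"
    and frob_add: "(u + v :: 'b) ^ q = u ^ q + v ^ q"
begin

section \<open>The small field inside the large one\<close>

lemma q_gt_1: "q > 1"
proof -
  have "card {0, 1 :: 'a} \<le> CARD('a)" by (rule card_mono) auto
  then show ?thesis by (simp add: card_a)
qed

lemma hom_0 [simp]: "\<iota> 0 = 0"
  using hom_add[of 0 0] by (metis add.right_neutral add_left_cancel)

lemma hom_diff: "\<iota> (x - y) = \<iota> x - \<iota> y"
  using hom_add[of "x - y" y] by simp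

lemma hom_eq_0_iff [simp]: "\<iota> x = 0 \<longleftrightarrow> x = 0"
proof
  assume "\<iota> x = 0"
  then show "x = 0" using hom_mult[of x "inverse x"] hom_1 by (cases "x = 0") auto
qed simp

lemma hom_inj: "\<iota> x = \<iota> y \<longleftrightarrow> x = y"
  using hom_eq_0_iff[of "x - y"] by (simp add: hom_diff)

lemma hom_divide: "\<iota> (x / y) = \<iota> x / \<iota> y"
proof (cases "y = 0")
  case False
  then have "\<iota> (x / y) * \<iota> y = \<iota> x" by (simp flip: hom_mult)
  then show ?thesis using False by (simp add: field_simps)
qed simp

lemma frob_diff: "(u - v :: 'b) ^ q = u ^ q - v ^ q"
  using frob_add[of "u - v" v] by simp

lemma hom_power_q [simp]: "\<iota> x ^ q = \<iota> x"
proof -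
  have "\<iota> x ^ i = \<iota> (x ^ i)" for i by (induction i) (auto simp: hom_1 hom_mult)
  then show ?thesis using power_CARD_eq_self[of x] by (simp add: card_a)
qed

text \<open>The image consists of fixed points of the \<open>q\<close>-th power map, and there are
  only \<open>q\<close> of those. Small-field scalars can thus be recognised by an equation.\<close>

lemma range_hom: "range \<iota> = {x. x ^ q = x}"
proof (rule card_subset_eq)
  have "card (range \<iota>) = q" by (simp add: card_image inj_on_def hom_inj card_a)
  then show "card (range \<iota>) = card {x::'b. x ^ q = x}"
    using card_pow_eq_self[OF card_b q_gt_1 pos(1)] by simp
qed auto

text \<open>A hyperplane of the large field over the small one, namely the kernel of the trace,
  written as the image of a linear map with one-dimensional kernel.\<close>

definition hyperplane :: "'b set" where
  "hyperplane = range (\<lambda>y. y ^ q - y)"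

text \<open>The fibres of the defining map are the cosets of the fixed field, so each has
  \<open>q\<close> elements.\<close>

lemma card_hyperplane: "card hyperplane = q ^ (t - 1)"
proof -
  have fiber: "card {w \<in> UNIV. w ^ q - w = v ^ q - v} = q" for v :: 'b
  proof -
    have "{w. w ^ q - w = v ^ q - v} = (\<lambda>s. v + s) ` {x. x ^ q = x}"
    proof (intro equalityI subsetI)
      fix w assume "w \<in> {w. w ^ q - w = v ^ q - v}"
      then have "(w - v) ^ q = w - v" by (simp add: frob_diff algebra_simps)
      then show "w \<in> (\<lambda>s. v + s) ` {x. x ^ q = x}" by (intro image_eqI[of _ _ "w - v"]) auto
    qed (auto simp: frob_add)
    then show ?thesis using card_pow_eq_self[OF card_b q_gt_1 pos(1)] by (simp add: card_image)
  qed
  have "card hyperplane * q = CARD('b)"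
    unfolding hyperplane_def
    using card_mult_le_of_fibers_ge[of UNIV q "\<lambda>y::'b. y ^ q - y"]
      card_le_mult_of_fibers_le[of UNIV "\<lambda>y::'b. y ^ q - y" q] fiber
    by (intro antisym) simp_all
  also have "\<dots> = q ^ (t - 1) * q" using pos by (metis card_b power_minus_mult)
  finally show ?thesis using q_gt_1 by simp
qed

lemma hyperplane_closed:
  "0 \<in> hyperplane" "u \<in> hyperplane \<Longrightarrow> v \<in> hyperplane \<Longrightarrow> u + v \<in> hyperplane"
  "u \<in> hyperplane \<Longrightarrow> v \<in> hyperplane \<Longrightarrow> u - v \<in> hyperplane"
  "u \<in> hyperplane \<Longrightarrow> \<iota> s * u \<in> hyperplane"
proof -
  show "0 \<in> hyperplane" unfolding hyperplane_def using q_gt_1 by (intro image_eqI[of _ _ 0]) auto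
  assume "u \<in> hyperplane"
  then obtain x where x: "u = x ^ q - x" by (auto simp: hyperplane_def)
  show "\<iota> s * u \<in> hyperplane" unfolding hyperplane_def
    by (intro image_eqI[of _ _ "\<iota> s * x"]) (auto simp: x power_mult_distrib algebra_simps)
  assume "v \<in> hyperplane"
  then obtain y where y: "v = y ^ q - y" by (auto simp: hyperplane_def)
  show "u + v \<in> hyperplane" unfolding hyperplane_def
    by (intro image_eqI[of _ _ "x + y"]) (auto simp: x y frob_add)
  show "u - v \<in> hyperplane" unfolding hyperplane_def
    by (intro image_eqI[of _ _ "x - y"]) (auto simp: x y frob_diff)
qed

text \<open>Restricting coordinate 0 lowers the rank of \<open>vecs m\<close> over the small field
  from \<open>t * m\<close> to \<open>t * m - 1\<close>; \<open>m > 0\<close> ensures that this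
  coordinate exists.\<close>

definition vertex :: "(nat \<Rightarrow> 'b) set" where
  "vertex = {a \<in> vecs m. a 0 \<in> hyperplane}"

lemma vertex_closed:
  "0 \<in> vertex" "u \<in> vertex \<Longrightarrow> v \<in> vertex \<Longrightarrow> u + v \<in> vertex"
  "u \<in> vertex \<Longrightarrow> v \<in> vertex \<Longrightarrow> u - v \<in> vertex"
  "u \<in> vertex \<Longrightarrow> \<iota> s \<odot> u \<in> vertex" "vertex \<subseteq> vecs m"
  using hyperplane_closed by (auto simp: vertex_def)

lemma card_vertex: "card vertex = q ^ (t * m - 1)"
proof -
  obtain m' where m': "m = Suc m'" using pos by (cases m) auto
  obtain t' where t': "t = Suc t'" using pos by (cases t) auto
  have "vertex = {v \<in> vecs m. \<forall>i<m. v i \<in> (if i = 0 then hyperplane else UNIV)}"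
    using pos by (auto simp: vertex_def)
  then have "card vertex = (\<Prod>i<m. card (if i = 0 then hyperplane else UNIV))"
    by (simp add: card_vecs_constrained)
  also have "\<dots> = q ^ (t - 1) * (q ^ t) ^ m'"
    unfolding m' prod.lessThan_Suc_shift by (simp add: card_hyperplane card_b)
  also have "\<dots> = q ^ (t * m - 1)"
    by (simp add: m' t' power_mult[symmetric] power_add[symmetric] algebra_simps)
  finally show ?thesis .
qed

text \<open>The \<open>m\<close> blocks \<open>(a, a ^ q)\<close> and the three coordinates in the image of \<open>\<iota>\<close> each force a
  scalar that maps the image of \<open>emb\<close> into itself to lie in the small field.\<close>
definition emb :: "(nat \<Rightarrow> 'b) \<Rightarrow> (nat \<Rightarrow> 'a) \<Rightarrow> nat \<Rightarrow> 'b" where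
  "emb a c = (\<lambda>i. if i < m then a i else if i < 2 * m then a (i - m) ^ q
     else if i < 2 * m + 3 then \<iota> (c (i - 2 * m)) else 0)"

lemma emb_in_vecs: "2 * m + 3 \<le> n \<Longrightarrow> emb a c \<in> vecs n"
  by (simp add: emb_def vecs_def)

lemma emb_add: "emb (a + a') (c + c') = emb a c + emb a' c'"
  by (auto simp: emb_def fun_eq_iff frob_add hom_add)

lemma emb_diff: "emb (a - a') (c - c') = emb a c - emb a' c'"
  by (auto simp: emb_def fun_eq_iff frob_diff hom_diff)

lemma emb_scale: "\<iota> s \<odot> emb a c = emb (\<iota> s \<odot> a) (s \<odot> c)"
  by (auto simp: emb_def fun_eq_iff power_mult_distrib hom_mult)

lemma emb_0: "emb 0 0 = 0"
  using emb_scale[of 0 0 0] by simp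

lemma emb_eq_0:
  assumes "emb a c = 0" "a \<in> vecs m" "c \<in> vecs 3"
  shows "a = 0 \<and> c = 0"
proof -
  have "a i = 0" for i
    using fun_cong[OF assms(1), of i] assms(2) by (cases "i < m") (auto simp: emb_def vecs_def)
  moreover have "c i = 0" for i
    using fun_cong[OF assms(1), of "2 * m + i"] assms(3) by (cases "i < 3") (auto simp: emb_def vecs_def)
  ultimately show ?thesis by (simp add: fun_eq_iff)
qed

lemma emb_eq_iff:
  assumes "a \<in> vecs m" "c \<in> vecs 3" "a' \<in> vecs m" "c' \<in> vecs 3"
  shows "emb a c = emb a' c' \<longleftrightarrow> a = a' \<and> c = c'"
proof
  assume "emb a c = emb a' c'"
  then have "emb (a - a') (c - c') = 0" by (simp add: emb_diff)
  then have "a - a' = 0 \<and> c - c' = 0" by (rule emb_eq_0) (use assms in auto)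
  then show "a = a' \<and> c = c'" by simp
qed simp

text \<open>One nonzero coordinate suffices. In a block, \<open>l * a ^ q\<close> must equal
  \<open>(l * a) ^ q\<close>, which gives \<open>l ^ q = l\<close>; in the last three coordinates,
  \<open>l\<close> is a quotient of two elements of the image of \<open>\<iota>\<close>.\<close>

lemma emb_scattered:
  assumes eq: "l \<odot> emb a c = emb a' c'" and "emb a c \<noteq> 0"
  shows "l \<in> range \<iota>"
proof -
  obtain i where i: "emb a c i \<noteq> 0" using assms(2) by (auto simp: fun_eq_iff)
  have frob: "l \<in> range \<iota>" if j: "j < m" "a j \<noteq> 0" for j
  proof -
    have "l * a j = a' j" using fun_cong[OF eq, of j] j by (simp add: emb_def)
    moreover have "l * a j ^ q = a' j ^ q" using fun_cong[OF eq, of "m + j"] j by (simp add: emb_def)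
    ultimately have "l * a j ^ q = l ^ q * a j ^ q" by (metis power_mult_distrib)
    then have "l ^ q = l" using j by simp
    then show ?thesis by (simp add: range_hom)
  qed
  consider "i < m" | "m \<le> i" "i < 2 * m" | "2 * m \<le> i" "i < 2 * m + 3"
    using i by (auto simp: emb_def split: if_splits)
  then show ?thesis
  proof cases
    case 1
    then show ?thesis using frob[of i] i by (simp add: emb_def)
  next
    case 2
    then show ?thesis using frob[of "i - m"] i q_gt_1 by (simp add: emb_def)
  next
    case 3
    then have "l * \<iota> (c (i - 2 * m)) = \<iota> (c' (i - 2 * m))" "c (i - 2 * m) \<noteq> 0"
      using fun_cong[OF eq, of i] i by (auto simp: emb_def)
    then have "l = \<iota> (c' (i - 2 * m) / c (i - 2 * m))" by (simp add: hom_divide field_simps)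
    then show ?thesis by simp
  qed
qed

text \<open>With \<open>C = vecs 3\<close> this is the whole scattered subspace \<open>U\<close> of
  rank \<open>t * m + 2\<close>; with the vectors of a planar point set it is the cone over that
  set.\<close>

definition emb_set :: "(nat \<Rightarrow> 'a) set \<Rightarrow> (nat \<Rightarrow> 'b) set" where
  "emb_set C = (\<lambda>(a, c). emb a c) ` (vertex \<times> C)"

lemma card_emb_set:
  assumes "C \<subseteq> vecs 3"
  shows "card (emb_set C) = card vertex * card C"
proof -
  have "inj_on (\<lambda>(a, c). emb a c) (vertex \<times> C)"
    using assms vertex_closed(5) by (auto simp: inj_on_def emb_eq_iff subset_iff)
  then show ?thesis by (simp add: emb_set_def card_image card_cartesian_product)
qed

lemma finite_emb_set: "C \<subseteq> vecs 3 \<Longrightarrow> finite (emb_set C)"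
  unfolding emb_set_def
  by (intro finite_imageI finite_cartesian_product)
    (use finite_subset[OF vertex_closed(5)] finite_subset[of C "vecs 3"] in auto)

end

subsection \<open>The cone over a planar blocking set\<close>

text \<open>The condition \<open>2 * m + 3 \<le> n\<close> makes room for the coordinates of
  \<open>emb\<close>; for \<open>m = n - k\<close> it is a rewriting of
  \<open>2 * k \<ge> n + 3\<close>.\<close>

locale blocking_cone = scattered_embedding \<iota> q t m
  for \<iota> :: "'a::{finite,field} \<Rightarrow> 'b::{finite,field}" and q t m +
  fixes Bbar :: "(nat \<Rightarrow> 'a) set set" and n k :: nat
  assumes minimal: "minimal_blocking_set 3 1 Bbar"
    and tangents: "\<And>P. P \<in> Bbar \<Longrightarrow> card (tangent_lines Bbar P) \<ge> 2"
    and dims: "n = m + k" "2 * m + 3 \<le> n" "k \<ge> 1"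
begin

text \<open>Inserting 0 puts the vectors of the vertex into the cone without appeal to
  \<open>Bbar\<close> being nonempty.\<close>

definition base :: "(nat \<Rightarrow> 'a) set" where
  "base = insert 0 (\<Union>Bbar)"

definition cone :: "(nat \<Rightarrow> 'b) set" where
  "cone = emb_set base"

definition cone_points :: "(nat \<Rightarrow> 'b) set set" where
  "cone_points = (\<lambda>v. lspan [v]) ` (cone - {0})"

lemma Bbar_points: "Bbar \<subseteq> proj_points 3"
  and Bbar_blocks: "is_subsp 3 2 L \<Longrightarrow> \<exists>P\<in>Bbar. P \<subseteq> L"
  using minimal by (auto simp: minimal_blocking_set_def blocking_set_def numeral_2_eq_2)

lemma Bbar_subsp: "P \<in> Bbar \<Longrightarrow> is_subsp 3 1 P"
  using Bbar_points by (auto simp: proj_points_def)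

lemma Bbar_eq_lspan:
  assumes "P \<in> Bbar" "c \<in> P" "c \<noteq> 0"
  shows "P = lspan [c]"
proof -
  obtain x where "P = lspan [x]" using Bbar_points assms(1) proj_points_iff[of P 3] by blast
  then show ?thesis using assms lspan_single_eq[of c x] by simp
qed

lemma base_subset: "base \<subseteq> vecs 3"
  using is_subsp_closed(5)[OF Bbar_subsp] unfolding base_def by blast

lemma base_scale: "c \<in> base \<Longrightarrow> s \<odot> c \<in> base"
  using Bbar_subsp is_subsp_closed(4) unfolding base_def by (metis UnionE UnionI insertE insertI1 insertI2 vscale_simps(3))

lemma card_base: "card base = card Bbar * (q - 1) + 1"
proof -
  define T where "T = \<Union>Bbar - {0}"
  have fin: "finite T" using finite_subset[OF base_subset] by (simp add: T_def base_def)
  have img: "(\<lambda>c. lspan [c]) ` T = Bbar"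
  proof (intro equalityI subsetI)
    fix P assume "P \<in> Bbar"
    then obtain x where "x \<noteq> 0" "P = lspan [x]"
      using Bbar_points proj_points_iff[of P 3] by blast
    moreover have "x \<in> lspan [x]" unfolding lspan_single by (metis rangeI vscale_simps(2))
    ultimately show "P \<in> (\<lambda>c. lspan [c]) ` T" using \<open>P \<in> Bbar\<close> by (auto simp: T_def)
  qed (use Bbar_eq_lspan in \<open>auto simp: T_def\<close>)
  have fiber: "card {w \<in> T. lspan [w] = lspan [c]} = q - 1" if c: "c \<in> T" for c
  proof -
    obtain P where P: "P \<in> Bbar" "c \<in> P" "c \<noteq> 0" using c by (auto simp: T_def)
    have "{w \<in> T. lspan [w] = lspan [c]} = P - {0}"
    proof (intro equalityI subsetI)
      fix w assume w: "w \<in> {w \<in> T. lspan [w] = lspan [c]}"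
      have "w \<in> lspan [w]" unfolding lspan_single by (metis rangeI vscale_simps(2))
      then show "w \<in> P - {0}" using w Bbar_eq_lspan[OF P] by (auto simp: T_def)
    qed (use P Bbar_eq_lspan[of P] in \<open>auto simp: T_def\<close>)
    moreover have "card P = q" "0 \<in> P"
      using card_is_subsp[OF Bbar_subsp[OF P(1)]] is_subsp_closed(1)[OF Bbar_subsp[OF P(1)]] by (auto simp: card_a)
    ultimately show ?thesis by (simp add: card_Diff_singleton)
  qed
  have "card T = card Bbar * (q - 1)"
    using card_mult_le_of_fibers_ge[OF fin, of "q - 1" "\<lambda>c. lspan [c]"]
      card_le_mult_of_fibers_le[OF fin, of "\<lambda>c. lspan [c]" "q - 1"] fiber img
    by (intro antisym) simp_all
  moreover have "base = insert 0 T" "0 \<notin> T" by (auto simp: base_def T_def)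
  ultimately show ?thesis using fin by simp
qed

section \<open>Counting the points of the cone\<close>

lemma cone_subset: "cone \<subseteq> vecs n"
  using dims emb_in_vecs by (auto simp: cone_def emb_set_def)

lemma cone_scale: "v \<in> cone \<Longrightarrow> \<iota> s \<odot> v \<in> cone"
  by (auto simp: cone_def emb_set_def emb_scale intro!: image_eqI[of _ _ "(_, _)"] vertex_closed base_scale)

lemma cone_scattered:
  assumes "v \<in> cone" "w \<in> cone" "v \<noteq> 0" "w = l \<odot> v"
  shows "l \<in> range \<iota>"
  using assms emb_scattered by (auto simp: cone_def emb_set_def)

text \<open>By scatteredness, two nonzero cone vectors span the same point only if they differ by a
  small-field scalar. Each point is therefore represented by exactly \<open>q - 1\<close> cone
  vectors.\<close>

lemma card_cone_points:
  "card cone_points = card Bbar * q ^ (t * m - 1) + (q ^ (t * m - 1) - 1) div (q - 1)"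
proof -
  define N where "N = q ^ (t * m - 1)"
  have "N > 0" using q_gt_1 by (simp add: N_def)
  have card: "card cone = N * (card Bbar * (q - 1) + 1)"
    unfolding cone_def card_emb_set[OF base_subset] card_vertex card_base N_def ..
  have fin: "finite cone" unfolding cone_def by (rule finite_emb_set[OF base_subset])
  have "0 \<in> cone" unfolding cone_def emb_set_def
    by (rule image_eqI[of _ _ "(0, 0)"]) (auto simp: emb_0 base_def vertex_closed)
  have fiber: "card {w \<in> cone - {0}. lspan [w] = lspan [v]} = q - 1" if v: "v \<in> cone - {0}" for v
  proof -
    have "{w \<in> cone - {0}. lspan [w] = lspan [v]} = (\<lambda>s. \<iota> s \<odot> v) ` (UNIV - {0})"
    proof (intro equalityI subsetI)
      fix w assume w: "w \<in> {w \<in> cone - {0}. lspan [w] = lspan [v]}"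
      have "w \<in> lspan [w]" unfolding lspan_single by (metis rangeI vscale_simps(2))
      with w obtain l where l: "w = l \<odot> v" by (auto simp: lspan_single)
      then have "l \<in> range \<iota>" using cone_scattered[of v w l] v w by auto
      then show "w \<in> (\<lambda>s. \<iota> s \<odot> v) ` (UNIV - {0})" using l w by auto
    next
      fix w assume "w \<in> (\<lambda>s. \<iota> s \<odot> v) ` (UNIV - {0})"
      then obtain s where s: "s \<noteq> 0" "w = \<iota> s \<odot> v" by auto
      then show "w \<in> {w \<in> cone - {0}. lspan [w] = lspan [v]}"
        using v cone_scale lspan_single_eq[of w v] by (auto simp: lspan_single)
    qed
    moreover have "inj_on (\<lambda>s. \<iota> s \<odot> v) (UNIV - {0})"
      using v by (auto simp: inj_on_def vscale_cancel_right hom_inj)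
    ultimately show ?thesis by (simp add: card_image card_Diff_singleton card_a)
  qed
  have fin': "finite (cone - {0})" using fin by simp
  have "card cone_points * (q - 1) = card (cone - {0})"
    unfolding cone_points_def
    using card_mult_le_of_fibers_ge[OF fin', of "q - 1" "\<lambda>v. lspan [v]"]
      card_le_mult_of_fibers_le[OF fin', of "\<lambda>v. lspan [v]" "q - 1"] fiber
    by (intro antisym) simp_all
  also have "\<dots> = N * (card Bbar * (q - 1) + 1) - 1"
    using fin \<open>0 \<in> cone\<close> card by (simp add: card_Diff_singleton)
  also have "\<dots> = card Bbar * N * (q - 1) + (N - 1)"
    using \<open>N > 0\<close> by (simp add: algebra_simps)
  finally have "card cone_points * (q - 1) = card Bbar * N * (q - 1) + (N - 1)" .
  then have "card cone_points = (card Bbar * N * (q - 1) + (N - 1)) div (q - 1)"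
    using q_gt_1 by (metis nonzero_mult_div_cancel_right zero_less_diff less_irrefl)
  also have "\<dots> = card Bbar * N + (N - 1) div (q - 1)"
    using q_gt_1 by simp
  finally show ?thesis by (simp add: N_def)
qed

section \<open>The cone meets every subspace of dimension \<open>k\<close>\<close>

lemma vertex_mult_q: "card vertex * q = CARD('b) ^ m"
  using pos power_minus_mult[of "t * m" q] by (simp add: card_vertex card_b power_mult[symmetric])

lemma emb_set_diff:
  assumes "u \<in> emb_set (vecs 3)" "v \<in> emb_set (vecs 3)"
  shows "u - v \<in> emb_set (vecs 3)"
proof -
  obtain a c a' c' where "u = emb a c" "v = emb a' c'" "a \<in> vertex" "a' \<in> vertex" "c \<in> vecs 3" "c' \<in> vecs 3"
    using assms by (auto simp: emb_set_def)
  then show ?thesis unfolding emb_set_def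
    by (intro image_eqI[of _ _ "(a - a', c - c')"]) (auto simp: emb_diff vertex_closed)
qed

text \<open>Addition maps \<open>W \<times> U\<close> into \<open>vecs n\<close>. The domain has
  \<open>Q ^ n * q ^ 2\<close> elements and every fibre injects into
  \<open>W \<inter> U\<close>.\<close>

lemma card_subsp_inter_emb_set:
  assumes W: "is_subsp n k W"
  shows "q ^ 2 \<le> card (W \<inter> emb_set (vecs 3))"
proof -
  define U where "U = emb_set (vecs 3)"
  define Q where "Q = CARD('b)"
  have "Q > 0" by (simp add: Q_def)
  have finU: "finite U" unfolding U_def by (rule finite_emb_set) simp
  have U: "U \<subseteq> vecs n" using dims emb_in_vecs by (auto simp: U_def emb_set_def)
  have finW: "finite W" using is_subsp_closed(5)[OF W] finite_subset finite_vecs by blast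
  have "card U = card vertex * q ^ 3"
    unfolding U_def by (simp add: card_emb_set card_vecs card_a)
  then have "card U = Q ^ m * q ^ 2"
    using vertex_mult_q by (simp add: Q_def power3_eq_cube power2_eq_square flip: mult.assoc)
  then have "Q ^ n * q ^ 2 = card (W \<times> U)"
    using dims by (simp add: card_cartesian_product card_is_subsp[OF W] Q_def power_add)
  also have "\<dots> \<le> card ((\<lambda>(w, u). w + u) ` (W \<times> U)) * card (W \<inter> U)"
  proof (rule card_le_mult_of_fibers_le)
    fix z assume "z \<in> W \<times> U"
    then obtain w0 u0 where z: "z = (w0, u0)" "w0 \<in> W" "u0 \<in> U" by auto
    let ?F = "{y \<in> W \<times> U. (case y of (w, u) \<Rightarrow> w + u) = (case z of (w, u) \<Rightarrow> w + u)}"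
    \<comment> \<open>Equal sums give \<open>w - w0 = u0 - u\<close>, with one side in
      \<open>W\<close> and the other in \<open>U\<close>.\<close>
    have "(\<lambda>(w, u). w - w0) ` ?F \<subseteq> W \<inter> U"
    proof (rule image_subsetI, clarify)
      fix w u assume w: "w \<in> W" "u \<in> U" "w + u = (case z of (w, u) \<Rightarrow> w + u)"
      then have "w - w0 = u0 - u" using z by (simp add: algebra_simps)
      then show "w - w0 \<in> W \<inter> U"
        using w z emb_set_diff[of u0 u] is_subsp_closed(3)[OF W, of w w0] by (auto simp: U_def)
    qed
    moreover have "inj_on (\<lambda>(w, u). w - w0) ?F"
      by (auto simp: inj_on_def z) (metis add_left_imp_eq)
    ultimately show "card ?F \<le> card (W \<inter> U)" using finW by (meson card_inj_on_le finite_Int)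
  qed (use finW finU in simp)
  also have "\<dots> \<le> Q ^ n * card (W \<inter> U)"
  proof (rule mult_right_mono)
    have "(\<lambda>(w, u). w + u) ` (W \<times> U) \<subseteq> vecs n" using is_subsp_closed(5)[OF W] U by auto
    then show "card ((\<lambda>(w, u). w + u) ` (W \<times> U)) \<le> Q ^ n"
      unfolding Q_def using card_mono[OF finite_vecs] by (metis card_vecs)
  qed simp
  finally show ?thesis using \<open>Q > 0\<close> by (simp add: U_def)
qed

text \<open>Either \<open>W\<close> contains a nonzero vertex vector, or projection from the vertex
  is injective on \<open>W \<inter> U\<close>. Then at least \<open>q ^ 2\<close> projected vectors
  contain two independent ones; the line they span meets \<open>Bbar\<close>, and the common point
  lifts back into \<open>W\<close>.\<close>

lemma cone_meets_subsp:
  assumes W: "is_subsp n k W"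
  shows "\<exists>v\<in>cone. v \<noteq> 0 \<and> v \<in> W"
proof -
  define R where "R = {(a, c). a \<in> vertex \<and> c \<in> vecs 3 \<and> emb a c \<in> W}"
  have "R \<subseteq> vecs m \<times> vecs 3" using vertex_closed(5) by (auto simp: R_def)
  then have finR: "finite R" by (rule finite_subset) simp
  show ?thesis
  proof (cases "\<exists>a. (a, 0) \<in> R \<and> a \<noteq> 0")
    case True
    then obtain a where "a \<in> vertex" "emb a 0 \<in> W" "a \<noteq> 0" by (auto simp: R_def)
    moreover from this have "emb a 0 \<noteq> 0" using emb_eq_0[of a 0] vertex_closed(5) by auto
    moreover have "emb a 0 \<in> cone" using \<open>a \<in> vertex\<close> unfolding cone_def emb_set_def
      by (intro image_eqI[of _ _ "(a, 0)"]) (auto simp: base_def)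
    ultimately show ?thesis by blast
  next
    case False
    have "inj_on snd R"
    proof (rule inj_onI, clarsimp)
      fix a a' c assume "(a, c) \<in> R" "(a', c) \<in> R"
      then have "(a - a', 0) \<in> R"
        using emb_diff[of a a' c c] vertex_closed is_subsp_closed(3)[OF W] by (auto simp: R_def)
      with False have "a - a' = 0" by blast
      then show "a = a'" by simp
    qed
    then have "card (snd ` R) = card R" by (rule card_image)
    moreover have "W \<inter> emb_set (vecs 3) \<subseteq> (\<lambda>(a, c). emb a c) ` R" by (auto simp: emb_set_def R_def)
    then have "card (W \<inter> emb_set (vecs 3)) \<le> card R" using finR by (rule surj_card_le[rotated])
    ultimately have big: "q ^ 2 \<le> card (snd ` R)" using card_subsp_inter_emb_set[OF W] by simp
    have "\<not> snd ` R \<subseteq> {0}"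
      using big q_gt_1 card_mono[of "{0}" "snd ` R"] one_less_power[of q 2] by auto
    then obtain c where "c \<in> snd ` R" "c \<noteq> 0" by blast
    then obtain a where ac: "(a, c) \<in> R" "c \<noteq> 0" by auto
    have "card (lspan [c]) = q" using card_lspan[of "[c]"] ac by (simp add: lin_indep_single card_a)
    then have "\<not> snd ` R \<subseteq> lspan [c]"
      using big q_gt_1 card_mono[of "lspan [c]" "snd ` R"] power_strict_increasing[of 1 2 q]
      by (auto simp: lspan_single)
    then obtain d where "d \<in> snd ` R" "d \<notin> lspan [c]" by blast
    then obtain a' where ad: "(a', d) \<in> R" "d \<notin> lspan [c]" by auto
    have "is_subsp 3 2 (lspan [c, d])" by (rule is_subsp_2_exists) (use ac ad in \<open>auto simp: R_def\<close>)
    then obtain P where P: "P \<in> Bbar" "P \<subseteq> lspan [c, d]" using Bbar_blocks by blast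
    then obtain p where p: "p \<noteq> 0" "P = lspan [p]" using Bbar_points proj_points_iff[of P 3] by blast
    have "p \<in> P" unfolding p lspan_single by (metis rangeI vscale_simps(2))
    then obtain s r where sr: "p = s \<odot> c + r \<odot> d" using P by (auto simp: lspan_pair)
    \<comment> \<open>The lift of \<open>p\<close> uses the coefficients that express
      \<open>p\<close> by \<open>c\<close> and \<open>d\<close>, so it is a combination of two
      vectors of \<open>W\<close>.\<close>
    define v where "v = emb (\<iota> s \<odot> a + \<iota> r \<odot> a') p"
    have vert: "\<iota> s \<odot> a + \<iota> r \<odot> a' \<in> vertex" using ac ad vertex_closed by (auto simp: R_def)
    have "v = \<iota> s \<odot> emb a c + \<iota> r \<odot> emb a' d" by (simp add: v_def sr emb_add emb_scale)
    then have "v \<in> W" using ac ad is_subsp_closed[OF W] by (auto simp: R_def)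
    moreover have "p \<in> base" using \<open>p \<in> P\<close> P by (auto simp: base_def)
    then have "v \<in> cone" using vert by (auto simp: v_def cone_def emb_set_def)
    moreover have "v \<noteq> 0"
      using emb_eq_0[of _ p] vert vertex_closed(5) p \<open>p \<in> base\<close> base_subset by (auto simp: v_def)
    ultimately show ?thesis by blast
  qed
qed

text \<open>Take for \<open>D\<close> two tangents at \<open>P\<close> with \<open>P\<close>
  removed. If \<open>c + p\<close> lay on such a tangent but outside \<open>P\<close>, then
  \<open>c\<close> would lie on the tangent too, hence in \<open>P\<close> by tangency, and so would
  \<open>c + p\<close>.\<close>

lemma tangent_complement:
  assumes P: "P \<in> Bbar"
  obtains D where "D \<subseteq> vecs 3" "card D = 2 * (q ^ 2 - q)" "\<And>c p. c \<in> base \<Longrightarrow> p \<in> P \<Longrightarrow> c + p \<notin> D"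
proof -
  have "\<not> card (tangent_lines Bbar P) \<le> 1" using tangents[OF P] by simp
  \<comment> \<open>An infinite set has \<open>card\<close> 0, so the lower bound 2 also yields
    finiteness.\<close>
  moreover have "finite (tangent_lines Bbar P)"
    using tangents[OF P] card.infinite by fastforce
  ultimately obtain L1 L2 where L12: "L1 \<in> tangent_lines Bbar P" "L2 \<in> tangent_lines Bbar P" "L1 \<noteq> L2"
    by (metis card_le_Suc0_iff_eq One_nat_def)
  have sub: "is_subsp 3 2 L" and tan: "{R \<in> Bbar. R \<subseteq> L} = {P}" if "L \<in> tangent_lines Bbar P" for L
    using that by (auto simp: tangent_lines_def)
  have PL: "P \<subseteq> L" if "L \<in> tangent_lines Bbar P" for L using tan[OF that] by blast
  have subP: "is_subsp 3 1 P" using Bbar_subsp P .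
  have out: "c + p \<notin> L - P" if L: "L \<in> tangent_lines Bbar P" and c: "c \<in> base" and p: "p \<in> P" for L c p
  proof
    assume cp: "c + p \<in> L - P"
    then have "c \<in> L" using is_subsp_closed(3)[OF sub[OF L], of "c + p" p] p PL[OF L] by auto
    have "c \<in> P"
    proof (cases "c = 0")
      case False
      then obtain R where R: "R \<in> Bbar" "c \<in> R" using c by (auto simp: base_def)
      then have "R \<subseteq> L" using Bbar_eq_lspan False \<open>c \<in> L\<close> lspan_single_subset_iff[OF sub[OF L]] by metis
      then have "R = P" using R tan[OF L] by blast
      then show ?thesis using R by simp
    qed (use is_subsp_closed(1)[OF subP] in simp)
    then show False using cp p is_subsp_closed(2)[OF subP] by auto
  qed
  have cardP: "card P = q" using card_is_subsp[OF subP] by (simp add: card_a)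
  have fin: "finite L" and cardL: "card L = q ^ 2" if "L \<in> tangent_lines Bbar P" for L
    using card_is_subsp[OF sub[OF that]] finite_subset[OF is_subsp_closed(5)[OF sub[OF that]] finite_vecs]
    by (auto simp: card_a)
  \<comment> \<open>A common vector outside \<open>P\<close> would, together with \<open>P\<close>,
    span both lines.\<close>
  have "L1 \<inter> L2 \<subseteq> P"
  proof
    fix y assume y: "y \<in> L1 \<inter> L2"
    show "y \<in> P"
    proof (rule ccontr)
      assume "y \<notin> P"
      obtain p where p: "p \<in> vecs 3" "p \<noteq> 0" "P = lspan [p]"
        using P Bbar_points proj_points_iff[of P 3] by blast
      have "y \<in> vecs 3" using y is_subsp_closed(5)[OF sub[OF L12(1)]] by auto
      then have s2: "is_subsp 3 2 (lspan [p, y])" using p \<open>y \<notin> P\<close> by (intro is_subsp_2_exists) auto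
      have "lspan [p, y] = L" if L: "L \<in> tangent_lines Bbar P" "y \<in> L" for L
      proof (rule card_subset_eq[OF fin[OF L(1)]])
        have "p \<in> L" using PL[OF L(1)] p lspan_single_subset_iff[OF sub[OF L(1)]] by simp
        then show "lspan [p, y] \<subseteq> L" using L is_subsp_closed[OF sub[OF L(1)]] by (auto simp: lspan_pair)
        show "card (lspan [p, y]) = card L" using card_is_subsp[OF s2] cardL[OF L(1)] by (simp add: card_a)
      qed
      then show False using L12 y by blast
    qed
  qed
  show thesis
  proof
    show "(L1 \<union> L2) - P \<subseteq> vecs 3" using sub L12 is_subsp_closed(5) by blast
    have "card ((L1 - P) \<union> (L2 - P)) = card (L1 - P) + card (L2 - P)"
      using fin L12 \<open>L1 \<inter> L2 \<subseteq> P\<close> by (intro card_Un_disjoint) auto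
    moreover have "card (L - P) = q ^ 2 - q" if "L \<in> tangent_lines Bbar P" for L
      using PL[OF that] fin[OF that] cardL[OF that] cardP by (metis card_Diff_subset finite_subset)
    ultimately show "card ((L1 \<union> L2) - P) = 2 * (q ^ 2 - q)" using L12 by (simp add: Un_Diff)
    show "c + p \<notin> (L1 \<union> L2) - P" if "c \<in> base" "p \<in> P" for c p
      using out[OF L12(1) that] out[OF L12(2) that] by auto
  qed
qed

text \<open>The lines over the small field that join \<open>x\<close> to the cone miss everything lying over the
  two tangents through the projection of \<open>x\<close>.\<close>
lemma card_joins_le:
  assumes x: "x \<in> cone" "x \<noteq> 0"
  defines "T \<equiv> (\<lambda>(v, s). v + \<iota> s \<odot> x) ` (cone \<times> UNIV) - range (\<lambda>s. \<iota> s \<odot> x)"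
  shows "card T + q + card vertex * (2 * (q ^ 2 - q)) \<le> card vertex * q ^ 3"
proof -
  obtain a b where ab: "x = emb a b" "a \<in> vertex" "b \<in> base" using x by (auto simp: cone_def emb_set_def)
  \<comment> \<open>If \<open>b = 0\<close>, then \<open>x\<close> lies in the vertex and any point
    of \<open>Bbar\<close> serves; blocking a single coordinate line shows that there is
    one.\<close>
  obtain P where P: "P \<in> Bbar" "b \<in> P"
  proof (cases "b = 0")
    case True
    have v: "(\<lambda>i. if i = 0 then 1 else 0) \<in> (vecs 3 :: (nat \<Rightarrow> 'a) set)"
      "(\<lambda>i. if i = 1 then 1 else 0) \<in> (vecs 3 :: (nat \<Rightarrow> 'a) set)" by (auto simp: vecs_def)
    have "is_subsp 3 2 (lspan [(\<lambda>i. if i = 0 then 1 else 0), (\<lambda>i. if i = 1 then 1 else 0) :: nat \<Rightarrow> 'a])"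
      by (rule is_subsp_2_exists) (use v in \<open>auto simp: fun_eq_iff lspan_single split: if_splits\<close>)
    then obtain P where "P \<in> Bbar" using Bbar_blocks by blast
    then show thesis using that[of P] True is_subsp_closed(1)[OF Bbar_subsp] by simp
  next
    case False
    then show thesis using ab that by (auto simp: base_def)
  qed
  obtain D where D: "D \<subseteq> vecs 3" "card D = 2 * (q ^ 2 - q)"
    "\<And>c p. c \<in> base \<Longrightarrow> p \<in> P \<Longrightarrow> c + p \<notin> D"
    using tangent_complement[OF P(1)] by blast
  have Pscale: "s \<odot> b \<in> P" for s using P is_subsp_closed(4)[OF Bbar_subsp] by blast
  define X where "X = range (\<lambda>s. \<iota> s \<odot> x)"
  have "inj (\<lambda>s. \<iota> s \<odot> x)" using x by (auto simp: inj_on_def vscale_cancel_right hom_inj)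
  then have cX: "card X = q" by (simp add: X_def card_image card_a)
  have joinD: "v + \<iota> s \<odot> x \<notin> emb_set D" "v + \<iota> s \<odot> x \<in> emb_set (vecs 3)" if v: "v \<in> cone" for v s
  proof -
    obtain a' c where v': "v = emb a' c" "a' \<in> vertex" "c \<in> base" using v by (auto simp: cone_def emb_set_def)
    have eq: "v + \<iota> s \<odot> x = emb (a' + \<iota> s \<odot> a) (c + s \<odot> b)" by (simp add: v' ab emb_scale emb_add)
    have "c \<in> vecs 3" "b \<in> vecs 3" using v' ab base_subset by auto
    then have in1: "a' + \<iota> s \<odot> a \<in> vertex" "c + s \<odot> b \<in> vecs 3"
      using v' ab vertex_closed by auto
    show "v + \<iota> s \<odot> x \<in> emb_set (vecs 3)" unfolding eq emb_set_def using in1 by auto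
    show "v + \<iota> s \<odot> x \<notin> emb_set D"
    proof
      assume "v + \<iota> s \<odot> x \<in> emb_set D"
      then obtain a'' c'' where "emb (a' + \<iota> s \<odot> a) (c + s \<odot> b) = emb a'' c''" "a'' \<in> vertex" "c'' \<in> D"
        by (auto simp: eq emb_set_def)
      then have "c + s \<odot> b \<in> D" using emb_eq_iff in1 vertex_closed(5) D(1) by (metis subsetD)
      then show False using D(3)[OF v'(3) Pscale] by simp
    qed
  qed
  have "0 \<in> cone" unfolding cone_def emb_set_def
    by (rule image_eqI[of _ _ "(0, 0)"]) (auto simp: emb_0 base_def vertex_closed)
  then have XD: "X \<inter> emb_set D = {}" "X \<subseteq> emb_set (vecs 3)" using joinD[of 0] by (auto simp: X_def)
  have TD: "T \<inter> emb_set D = {}" "T \<subseteq> emb_set (vecs 3)" "T \<inter> X = {}"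
    using joinD by (auto simp: T_def X_def)
  have fin: "finite (emb_set (vecs 3))" "finite (emb_set D)" using D by (auto intro: finite_emb_set)
  have finT: "finite T" "finite X" using finite_subset[OF TD(2) fin(1)] finite_subset[OF XD(2) fin(1)] by auto
  have "card T + q + card vertex * (2 * (q ^ 2 - q)) = card T + card X + card (emb_set D)"
    by (simp add: cX card_emb_set D)
  \<comment> \<open>The three sets are pairwise disjoint parts of the scattered subspace.\<close>
  also have "\<dots> = card (T \<union> X \<union> emb_set D)"
    using TD XD fin finT by (subst card_Un_disjoint; (subst card_Un_disjoint)?) auto
  also have "\<dots> \<le> card (emb_set (vecs 3))"
    by (rule card_mono) (use TD XD fin D in \<open>auto simp: emb_set_def\<close>)
  also have "\<dots> = card vertex * q ^ 3" by (simp add: card_emb_set card_vecs card_a)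
  finally show ?thesis .
qed

text \<open>The joins of \<open>x\<close> to the cone split into classes, one for each small-field
  line through \<open>x\<close>. A subspace through \<open>x\<close> that avoids one representative
  of a class avoids the whole class, so only the representatives in \<open>S\<close> are
  obstructions, and there are fewer than \<open>Q ^ m\<close> of them.\<close>

lemma tangent_subspace_exists:
  assumes x: "x \<in> cone" "x \<noteq> 0"
  obtains W where "is_subsp n k W" "x \<in> W" "\<And>v. v \<in> cone \<Longrightarrow> v \<in> W \<Longrightarrow> v \<in> lspan [x]"
proof -
  define X where "X = range (\<lambda>s. \<iota> s \<odot> x)"
  define T where "T = (\<lambda>(v, s). v + \<iota> s \<odot> x) ` (cone \<times> UNIV) - X"
  have fin: "finite T"
    using finite_subset[OF cone_subset] by (auto simp: T_def)
  \<comment> \<open>The class of \<open>v\<close>: its small-field span with \<open>x\<close>,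
    without the multiples of \<open>x\<close>. For \<open>v\<close> in \<open>T\<close> it has
    \<open>q ^ 2 - q\<close> elements.\<close>
  define f where "f v = (\<lambda>(r, s). \<iota> r \<odot> v + \<iota> s \<odot> x) ` ((UNIV - {0}) \<times> UNIV)" for v
  define S where "S = (\<lambda>C. SOME s. s \<in> C) ` f ` T"
  have self: "v \<in> f v" for v unfolding f_def
    by (rule image_eqI[of _ _ "(1, 0)"]) (auto simp: hom_1)
  have f_trans: "w \<in> f v \<Longrightarrow> f w = f v" for v w
  proof -
    have sub: "f w \<subseteq> f v" if w: "w \<in> f v" for v w
    proof
      fix y assume "y \<in> f w"
      then obtain r s where y: "r \<noteq> 0" "y = \<iota> r \<odot> w + \<iota> s \<odot> x" by (auto simp: f_def)
      obtain r' s' where w': "r' \<noteq> 0" "w = \<iota> r' \<odot> v + \<iota> s' \<odot> x" using w by (auto simp: f_def)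
      have "y = \<iota> (r * r') \<odot> v + \<iota> (r * s' + s) \<odot> x"
        by (simp add: y w' vscale_algebra hom_mult hom_add add.assoc)
      then show "y \<in> f v" unfolding f_def using y w'
        by (intro image_eqI[of _ _ "(r * r', r * s' + s)"]) auto
    qed
    assume w: "w \<in> f v"
    then obtain r s where rs: "r \<noteq> 0" "w = \<iota> r \<odot> v + \<iota> s \<odot> x" by (auto simp: f_def)
    have "v = \<iota> (inverse r) \<odot> w + \<iota> (- s * inverse r) \<odot> x"
    proof -
      have "\<iota> (inverse r) * \<iota> r = 1" using rs hom_mult[of "inverse r" r] hom_1 by simp
      moreover have "\<iota> (- s * inverse r) = - (\<iota> (inverse r) * \<iota> s)"
        using hom_diff[of 0 "s * inverse r"] by (simp add: hom_mult mult.commute)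
      ultimately show ?thesis by (simp add: rs vscale_algebra)
    qed
    then have "v \<in> f w" unfolding f_def using rs
      by (intro image_eqI[of _ _ "(inverse r, - s * inverse r)"]) auto
    then show "f w = f v" using sub w by blast
  qed
  have f_sub: "f v \<subseteq> T" if v: "v \<in> T" for v
  proof
    fix w assume w: "w \<in> f v"
    then obtain r s where rs: "r \<noteq> 0" "w = \<iota> r \<odot> v + \<iota> s \<odot> x" by (auto simp: f_def)
    obtain v0 s0 where v0: "v0 \<in> cone" "v = v0 + \<iota> s0 \<odot> x" using v by (auto simp: T_def)
    have "w = \<iota> r \<odot> v0 + \<iota> (r * s0 + s) \<odot> x"
      by (simp add: rs v0 vscale_algebra hom_mult hom_add add.assoc)
    then have "w \<in> (\<lambda>(v, s). v + \<iota> s \<odot> x) ` (cone \<times> UNIV)"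
      by (intro image_eqI[of _ _ "(\<iota> r \<odot> v0, r * s0 + s)"]) (auto simp: cone_scale v0)
    moreover have "w \<notin> X"
    proof
      assume "w \<in> X"
      then obtain s1 where s1: "w = \<iota> s1 \<odot> x" by (auto simp: X_def)
      have "v \<in> f w" using f_trans[OF w] self by simp
      then obtain r2 s2 where "v = \<iota> r2 \<odot> w + \<iota> s2 \<odot> x" by (auto simp: f_def)
      then have "v = \<iota> (r2 * s1 + s2) \<odot> x" by (simp add: s1 vscale_algebra hom_mult hom_add)
      then show False using v by (auto simp: T_def X_def)
    qed
    ultimately show "w \<in> T" by (simp add: T_def)
  qed
  have fiber: "q ^ 2 - q \<le> card {w \<in> T. f w = f v}" if v: "v \<in> T" for v
  proof -
    have "inj_on (\<lambda>(r, s). \<iota> r \<odot> v + \<iota> s \<odot> x) ((UNIV - {0}) \<times> UNIV)"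
    proof (rule inj_onI)
      fix y z :: "'a \<times> 'a"
      assume yz: "(case y of (r, s) \<Rightarrow> \<iota> r \<odot> v + \<iota> s \<odot> x) = (case z of (r, s) \<Rightarrow> \<iota> r \<odot> v + \<iota> s \<odot> x)"
      obtain r s r' s' where rs: "y = (r, s)" "z = (r', s')" by (cases y, cases z)
      then have "\<iota> r \<odot> v + \<iota> s \<odot> x = \<iota> r' \<odot> v + \<iota> s' \<odot> x" using yz by simp
      then have e: "\<iota> (r - r') \<odot> v = \<iota> (s' - s) \<odot> x" by (simp add: hom_diff vscale_algebra algebra_simps)
      have "r = r'"
      proof (rule ccontr)
        assume "r \<noteq> r'"
        then have "v = (inverse (\<iota> (r - r')) * \<iota> (s' - s)) \<odot> x" using e by (simp add: vscale_cancel)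
        then have "v = \<iota> ((s' - s) / (r - r')) \<odot> x" by (simp add: hom_divide field_simps)
        then show False using v by (auto simp: T_def X_def)
      qed
      with e x have "\<iota> (s' - s) = 0" by auto
      then show "y = z" using rs \<open>r = r'\<close> by simp
    qed
    then have "card (f v) = (q - 1) * q"
      unfolding f_def by (simp add: card_image card_cartesian_product card_Diff_singleton card_a)
    moreover have "f v \<subseteq> {w \<in> T. f w = f v}" using f_sub[OF v] f_trans by auto
    ultimately show ?thesis using fin
      by (metis (no_types, lifting) card_mono diff_mult_distrib finite_subset mem_Collect_eq mult_1 power2_eq_square subsetI)
  qed
  have SfT: "\<exists>v\<in>T. s \<in> f v" if s: "s \<in> S" for s
  proof -
    obtain v where v: "v \<in> T" "s = (SOME s. s \<in> f v)" using s by (auto simp: S_def)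
    have "s \<in> f v" unfolding v(2) by (rule someI[where P="\<lambda>s. s \<in> f v", OF self])
    then show ?thesis using v(1) by blast
  qed
  have "card S < CARD('b) ^ (n - k)"
  proof -
    define N where "N = card vertex"
    have "N > 0" using q_gt_1 by (simp add: N_def card_vertex)
    have "card S \<le> card (f ` T)" unfolding S_def by (rule card_image_le) (use fin in simp)
    then have "card S * (q ^ 2 - q) \<le> card (f ` T) * (q ^ 2 - q)" by (rule mult_right_mono) simp
    also have "\<dots> \<le> card T" using card_mult_le_of_fibers_ge[OF fin fiber] .
    finally have c: "card S * (q ^ 2 - q) + q + N * (2 * (q ^ 2 - q)) \<le> N * q ^ 3"
      using card_joins_le[OF x] by (simp add: T_def X_def N_def)
    \<comment> \<open>Two tangents suffice because \<open>2 * (q ^ 2 - q) \<ge> q ^ 2\<close> for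
      \<open>q \<ge> 2\<close>; the additional summand \<open>q\<close> makes the bound strict. The
      substitution \<open>q = r + 2\<close> removes subtraction.\<close>
    have "card S < N * q"
    proof (rule ccontr)
      assume "\<not> ?thesis"
      then have "N * q * (q ^ 2 - q) \<le> card S * (q ^ 2 - q)" by (intro mult_right_mono) auto
      with c have le: "N * q * (q ^ 2 - q) + q + N * (2 * (q ^ 2 - q)) \<le> N * q ^ 3" by linarith
      obtain r where r: "q = r + 2" using q_gt_1 by (metis Suc_leI add.commute le_iff_add numeral_2_eq_2 One_nat_def)
      have "q ^ 2 - q = (r + 1) * (r + 2)" by (simp add: r power2_eq_square algebra_simps)
      with le have "N * (r + 2) * ((r + 1) * (r + 2)) + (r + 2) + N * (2 * ((r + 1) * (r + 2))) \<le> N * (r + 2) ^ 3"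
        by (simp only: r)
      moreover have "N * (r + 2) * ((r + 1) * (r + 2)) + N * (2 * ((r + 1) * (r + 2))) = N * (r + 2) ^ 3 + N * (r * (r + 2))"
        by (simp add: power3_eq_cube algebra_simps)
      ultimately show False by linarith
    qed
    then show ?thesis using vertex_mult_q dims by (simp add: N_def)
  qed
  \<comment> \<open>A representative that is a large-field multiple of \<open>x\<close> would make a
    cone vector such a multiple. Scatteredness then forces a small-field scalar, contradicting the
    removal of \<open>X\<close>.\<close>
  moreover have "S \<inter> lspan [x] = {}"
  proof (rule ccontr)
    assume "\<not> ?thesis"
    then obtain s l where "s \<in> S" and l: "s = l \<odot> x" by (auto simp: lspan_single)
    then have "s \<in> T" using SfT f_sub by blast
    then obtain v r where v: "v \<in> cone" "s = v + \<iota> r \<odot> x" by (auto simp: T_def)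
    then have "v = (l - \<iota> r) \<odot> x" using l by (simp add: vscale_algebra algebra_simps)
    then have "l - \<iota> r \<in> range \<iota>" using cone_scattered[of x v] x v by blast
    then obtain r' where "l = \<iota> (r' + r)" by (auto simp: hom_add algebra_simps)
    then show False using \<open>s \<in> T\<close> l by (auto simp: T_def X_def)
  qed
  moreover have "finite S" unfolding S_def using fin by simp
  moreover have "x \<in> vecs n" using x cone_subset by blast
  ultimately obtain W where W: "is_subsp n k W" "x \<in> W" "W \<inter> S = {}"
    using subspace_avoiding_exists[of x n S k] x dims by auto
  show thesis
  proof
    fix v assume v: "v \<in> cone" "v \<in> W"
    show "v \<in> lspan [x]"
    proof (rule ccontr)
      assume nv: "v \<notin> lspan [x]"
      have "v \<in> T" unfolding T_def
      proof
        show "v \<in> (\<lambda>(v, s). v + \<iota> s \<odot> x) ` (cone \<times> UNIV)"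
          by (rule image_eqI[of _ _ "(v, 0)"]) (use v in auto)
        show "v \<notin> X" using nv by (auto simp: X_def lspan_single)
      qed
      define s where "s = (SOME s. s \<in> f v)"
      have "s \<in> f v" unfolding s_def by (rule someI[where P="\<lambda>s. s \<in> f v", OF self])
      \<comment> \<open>The representative is a combination of \<open>v\<close> and
        \<open>x\<close>, both of which lie in \<open>W\<close>.\<close>
      then have "s \<in> W" using v W(2) is_subsp_closed[OF W(1)] by (auto simp: f_def)
      moreover have "s \<in> S" using \<open>v \<in> T\<close> by (auto simp: S_def s_def)
      ultimately show False using W by blast
    qed
  qed (use W in auto)
qed

text \<open>A proper subset omits some point \<open>lspan [x]\<close>, and the tangent subspace at
  \<open>x\<close> meets the cone in no other point, so the subset fails to block it.\<close>

lemma minimal_cone_points: "minimal_blocking_set n (k - 1) cone_points"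
proof -
  \<comment> \<open>Projective dimension \<open>k - 1\<close> is vector dimension \<open>k\<close>;
    the natural subtraction is harmless since \<open>k \<ge> 1\<close>.\<close>
  have "k - 1 + 1 = k" using dims by simp
  have "cone_points \<subseteq> proj_points n"
    unfolding cone_points_def
  proof (rule image_subsetI)
    fix v assume "v \<in> cone - {0}"
    then show "lspan [v] \<in> proj_points n" unfolding proj_points_iff using cone_subset by blast
  qed
  moreover have "\<exists>P\<in>cone_points. P \<subseteq> W" if W: "is_subsp n k W" for W
  proof -
    obtain v where "v \<in> cone" "v \<noteq> 0" "v \<in> W" using cone_meets_subsp[OF W] by blast
    then show ?thesis
      by (intro bexI[of _ "lspan [v]"]) (simp_all add: lspan_single_subset_iff[OF W] cone_points_def)
  qed
  moreover have "\<not> blocking_set n (k - 1) B'" if B': "B' \<subset> cone_points" for B'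
  proof
    assume B: "blocking_set n (k - 1) B'"
    obtain x where x: "x \<in> cone" "x \<noteq> 0" "lspan [x] \<notin> B'"
      using B' unfolding cone_points_def by blast
    obtain W where W: "is_subsp n k W" "\<And>v. v \<in> cone \<Longrightarrow> v \<in> W \<Longrightarrow> v \<in> lspan [x]"
      using tangent_subspace_exists[OF x(1,2)] by metis
    obtain R where R: "R \<in> B'" "R \<subseteq> W"
      using B W(1) \<open>k - 1 + 1 = k\<close> unfolding blocking_set_def by metis
    obtain v where v: "v \<in> cone" "v \<noteq> 0" "R = lspan [v]"
      using R(1) B' unfolding cone_points_def by blast
    have "v \<in> W" using R(2) unfolding v(3) lspan_single_subset_iff[OF W(1)] .
    then have "R = lspan [x]" unfolding v(3) using lspan_single_eq[OF W(2) v(2)] v(1) by blast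
    then show False using x(3) R(1) by simp
  qed
  ultimately show ?thesis
    unfolding minimal_blocking_set_def blocking_set_def \<open>k - 1 + 1 = k\<close> by blast
qed

end

theorem theorem4p8:
  fixes n k t q :: nat
    and Bbar :: "(nat \<Rightarrow> 'a::{finite,field}) set set"
  assumes "n > 0" "k > 0" "t > 0" "k < n" "2 * k \<ge> n + 3"
    and "prime_power q"
    and "CARD('a) = q"
    and "CARD('b::{finite,field}) = q ^ t"
    and "minimal_blocking_set 3 1 Bbar"
    and "\<forall>P\<in>Bbar. card (tangent_lines Bbar P) \<ge> 2"
  shows "\<exists>B :: (nat \<Rightarrow> 'b) set set. minimal_blocking_set n (k - 1) B \<and>
           card B = card Bbar * q ^ (n*t - k*t - 1) + (q ^ (n*t - k*t - 1) - 1) div (q - 1)"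
proof -
  obtain p e where pe: "prime p" "q = p ^ e" using assms(6) by (auto simp: prime_power_def)
  have ca: "CHAR('a) = p"
    by (rule CHAR_CARD_prime_power[OF _ pe(1)]) (simp only: assms(7) pe(2))
  have cb: "CHAR('b) = p"
    by (rule CHAR_CARD_prime_power[OF _ pe(1)]) (simp only: assms(8) pe(2) power_mult[symmetric])
  have card: "CARD('b) = CARD('a) ^ t" and char: "CHAR('b) = CHAR('a)"
    by (simp_all only: assms(7,8) ca cb)
  obtain \<iota> :: "'a \<Rightarrow> 'b" where \<iota>: "\<And>x y. \<iota> (x + y) = \<iota> x + \<iota> y" "\<And>x y. \<iota> (x * y) = \<iota> x * \<iota> y" "\<iota> 1 = 1"
    using finite_field_embedding[OF card assms(3) char] by blast
  \<comment> \<open>Here \<open>q\<close> is a power of the characteristic \<open>p\<close> of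
    \<open>'b\<close>.\<close>
  have frob: "(u + v :: 'b) ^ q = u ^ q + v ^ q" for u v
    by (rule freshmans_dream') (simp_all only: cb pe)
  interpret blocking_cone \<iota> q t "n - k" Bbar n k
  proof unfold_locales
    show "t > 0" "n - k > 0" "n = n - k + k" "2 * (n - k) + 3 \<le> n" "k \<ge> 1"
      using assms(2-5) by linarith+
    show "2 \<le> card (tangent_lines Bbar P)" if "P \<in> Bbar" for P
      using assms(10) that by blast
  qed (fact assms(7-9) \<iota> frob)+
  have "t * (n - k) = n * t - k * t" by (simp add: diff_mult_distrib2 mult.commute)
  then show ?thesis using minimal_cone_points card_cone_points by (intro exI[of _ cone_points]) simp
qed

end
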